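(* Let $d\ge 2$, let $\mathcal{R}\subset\mathbb{R}^d$ be a compact region, and let the oriented hypersurface patches $\mathcal{S}_1,\dotsc,\mathcal{S}_m$, with sufficiently smooth parametrizations $\boldsymbol{s}_i:D_i\to\mathcal{S}_i$, $D_i\subset\mathbb{R}^{d-1}$, represent $\partial\mathcal{R}$ with orientations consistent with the outward orientation of $\partial\mathcal{R}$. Let $\boldsymbol{x}_0\in\mathbb{R}^d$ be any point (the scaling center). For $0\le\rho\le 1$ and $\boldsymbol{t}=(t_1,\dotsc,t_{d-1})\in D_i$ define $$\boldsymbol{\varphi}_i(\rho,\boldsymbol{t})=\boldsymbol{x}_0+\rho\bigl(\boldsymbol{s}_i(\boldsymbol{t})-\boldsymbol{x}_0\bigr),$$ $$J_i(\rho,\boldsymbol{t})=\rho^{d-1}\det\Bigl[\boldsymbol{s}_i(\boldsymbol{t})-\boldsymbol{x}_0\quad \frac{\partial\boldsymbol{s}_i}{\partial t_1}(\boldsymbol{t})\quad\cdots\quad\frac{\partial\boldsymbol{s}_i}{\partial t_{d-1}}(\boldsymbol{t})\Bigr],$$ and let $\mathcal{R}^+=\bigcup_{i=1}^m\boldsymbol{\varphi}_i([0,1]\times D_i)$. Let $f$ be a real-valued function that is smooth on an open set containing $\mathcal{R}^+$. Then $$\int_{\mathcal{R}}f(\boldsymbol{x})\,d\boldsymbol{x}=\sum_{i=1}^{m}\int_0^1\int_{D_i}f\bigl(\boldsymbol{\varphi}_i(\rho,\boldsymbol{t})\bigr)\,J_i(\rho,\boldsymbol{t})\,d\boldsymbol{t}\,d\rho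 .$$
   Context: The boundary of the compact region $\mathcal{R}\subset\mathbb{R}^d$ is represented by finitely many oriented hypersurface patches $\mathcal{S}_i$, each given by a sufficiently smooth parametrization $\boldsymbol{s}_i:D_i\to\mathcal{S}_i$ with $D_i\subset\mathbb{R}^{d-1}$. Each $D_i$ is assumed to be a canonical integration domain (such as a hypercube or a simplex) or a domain having a boundary representation of the same kind. The oriented normal measure induced by $\boldsymbol{s}_i$ is $\boldsymbol{N}_i(\boldsymbol{t})\,d\boldsymbol{t}$, where $\boldsymbol{N}_i(\boldsymbol{t})\in\mathbb{R}^d$ is the vector determined by $$\boldsymbol{a}\cdot\boldsymbol{N}_i(\boldsymbol{t})=\det\Bigl[\boldsymbol{a}\quad\frac{\partial\boldsymbol{s}_i}{\partial t_1}(\boldsymbol{t})\quad\cdots\quad\frac{\partial\boldsymbol{s}_i}{\partial t_{d-1}}(\boldsymbol{t})\Bigr]\quad\text{for all }\boldsymbol{a}\in\mathbb{R}^d .$$ That the oriented patches represent $\partial\mathcal{R}$ means that together they form $\partial\mathcal{R}$ oriented by its outward normal, with $\boldsymbol{N}_i$ as the oriented (outward) normal. The parametrizations $\boldsymbol{s}_i$ and the maps $\boldsymbol{\varphi}_i$ need not be globally injective, provided the oriented image counts the region with the correct multiplicity. The determinant in $J_i$ is a signed quantity (no absolute value). The region $\mathcal{R}$ is not assumed to be star-convex with respect to $\boldsymbol{x}_0$, and $\boldsymbol{x}_0$ need not lie in $\mathcal{R}$; thus $\mathcal{R}^+$ may strictly contain $\mathcal{R}$. *)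

theory Defs
  imports "HOL-Analysis.Analysis"
begin

text \<open>
  Vectors of \<open>\<real>\<^sup>d\<close> have type \<^typ>\<open>real^'k option\<close> and parameters \<open>t \<in> \<real>\<^sup>d\<^sup>-\<^sup>1\<close> have type
  \<^typ>\<open>real^'k\<close>, so that \<open>d = CARD('k) + 1\<close> ranges over all integers \<open>\<ge> 2\<close>. Index \<open>None\<close> stands
  for position 1 and \<open>Some j\<close> for the position after \<open>j\<close>, both for coordinates (rows) and for the
  columns of \<open>[a, \<partial>s/\<partial>t\<^sub>1, \<dots>, \<partial>s/\<partial>t\<^sub>d\<^sub>-\<^sub>1]\<close>. No order on \<open>'k\<close> is needed: reordering it
  permutes rows and columns simultaneously and does not change the determinant.
\<close>

text \<open>The following notion of \<open>C\<^sup>n\<close> is meant for open \<open>S\<close>.\<close>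

primrec Ck_on :: "nat \<Rightarrow> ('a::euclidean_space \<Rightarrow> 'b::real_normed_vector) \<Rightarrow> 'a set \<Rightarrow> bool" where
  "Ck_on 0 f S \<longleftrightarrow> continuous_on S f"
| "Ck_on (Suc n) f S \<longleftrightarrow>
     f differentiable_on S \<and> (\<forall>v. Ck_on n (\<lambda>x. frechet_derivative f (at x) v) S)"

definition smooth_on :: "('a::euclidean_space \<Rightarrow> 'b::real_normed_vector) \<Rightarrow> 'a set \<Rightarrow> bool" where
  "smooth_on f S \<longleftrightarrow> (\<forall>n. Ck_on n f S)"

definition partial_deriv :: "(real^'k \<Rightarrow> real^'k option) \<Rightarrow> 'k \<Rightarrow> real^'k \<Rightarrow> real^'k option" where
  "partial_deriv s j t = vector_derivative (\<lambda>h. s (t + h *\<^sub>R axis j 1)) (at 0)"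

definition tangent_det ::
    "(real^'k \<Rightarrow> real^'k option) \<Rightarrow> real^'k \<Rightarrow> real^'k option \<Rightarrow> real" where
  "tangent_det s t a =
     det (\<chi> row col. (case col of None \<Rightarrow> a | Some j \<Rightarrow> partial_deriv s j t) $ row)"

definition normal_vec :: "(real^'k \<Rightarrow> real^'k option) \<Rightarrow> real^'k \<Rightarrow> real^'k option" where
  "normal_vec s t = (THE N. \<forall>a. a \<bullet> N = tangent_det s t a)"

lemma linear_tangent_det: "linear (tangent_det s t)"
proof -
  have eq: "tangent_det s t a =
      det (\<chi> col. if col = None then a else partial_deriv s (the col) t)" for a
    unfolding tangent_det_def
    by (subst det_transpose [symmetric], rule arg_cong [where f = det])
       (auto simp: transpose_def vec_eq_iff split: option.split)
  show ?thesis
    by (rule linearI) (simp_all add: eq det_row_add det_row_mul scalar_mult_eq_scaleR [symmetric])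
qed

lemma inner_normal_vec: "a \<bullet> normal_vec s t = tangent_det s t a"
proof -
  let ?N = "\<Sum>b\<in>Basis. tangent_det s t b *\<^sub>R b"
  have ex: "\<forall>a. a \<bullet> ?N = tangent_det s t a"
  proof
    fix a
    have "tangent_det s t a = tangent_det s t (\<Sum>b\<in>Basis. (a \<bullet> b) *\<^sub>R b)"
      by (simp add: euclidean_representation)
    also have "\<dots> = (\<Sum>b\<in>Basis. (a \<bullet> b) * tangent_det s t b)"
      by (simp add: linear_sum [OF linear_tangent_det] linear_scale [OF linear_tangent_det])
    finally show "a \<bullet> ?N = tangent_det s t a"
      by (simp add: inner_sum_right mult.commute)
  qed
  have "\<forall>a. a \<bullet> normal_vec s t = tangent_det s t a"
    unfolding normal_vec_def
  proof (rule theI [where a = "?N"])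
    show "\<forall>a. a \<bullet> ?N = tangent_det s t a" by (rule ex)
  next
    fix N assume "\<forall>a. a \<bullet> N = tangent_det s t a"
    then have "\<forall>a. a \<bullet> N = a \<bullet> ?N" using ex by simp
    then show "N = ?N" by (simp only: vector_eq_ldot)
  qed
  then show ?thesis by blast
qed

text \<open>\<open>E\<close> has \<open>n\<close>-dimensional Hausdorff measure zero; meant for \<open>n \<ge> 1\<close>.\<close>

definition hausdorff_null :: "nat \<Rightarrow> 'a::metric_space set \<Rightarrow> bool" where
  "hausdorff_null n E \<longleftrightarrow>
     (\<forall>\<epsilon>>0. \<exists>C :: nat \<Rightarrow> 'a set. E \<subseteq> (\<Union>j. C j) \<and> (\<forall>j. bounded (C j)) \<and>
        summable (\<lambda>j. diameter (C j) ^ n) \<and> (\<Sum>j. diameter (C j) ^ n) < \<epsilon>)"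

text \<open>
  Near \<open>p\<close> the set \<open>R\<close> is the region \<open>g \<le> 0\<close> below a \<open>C\<^sup>1\<close> level hypersurface through \<open>p\<close>, and
  \<open>\<nu>\<close> is the normalised gradient of \<open>g\<close> at \<open>p\<close>.
\<close>

definition outward_unit_normal :: "'a::euclidean_space set \<Rightarrow> 'a \<Rightarrow> 'a \<Rightarrow> bool" where
  "outward_unit_normal R p \<nu> \<longleftrightarrow> norm \<nu> = 1 \<and>
     (\<exists>U (g :: 'a \<Rightarrow> real) c. open U \<and> p \<in> U \<and> Ck_on 1 g U \<and> R \<inter> U = {x \<in> U. g x \<le> 0} \<and>
        g p = 0 \<and> c > 0 \<and> (g has_derivative (\<lambda>v. c * (\<nu> \<bullet> v))) (at p))"

text \<open>
  Domains are compact sets with Lebesgue-null boundary (hypercubes, simplices, and compact sets whose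
  boundary consists of finitely many hypersurface patches are of this kind).
\<close>

definition patch :: "(real^'k) set \<Rightarrow> (real^'k \<Rightarrow> real^'k option) \<Rightarrow> bool" where
  "patch D s \<longleftrightarrow> compact D \<and> negligible (frontier D) \<and> (\<exists>V. open V \<and> D \<subseteq> V \<and> Ck_on 1 s V)"

text \<open>
  The patches \<open>s i\<close> cover exactly the boundary of \<open>R\<close>, and surface-almost every boundary point has an
  outward normal \<open>\<nu>\<close> and is covered with oriented multiplicity 1: a parameter mapped to it counts
  \<open>+1\<close> where the patch normal points outwards and \<open>-1\<close> where it points inwards. In particular this holds
  if the patch normals are outward and almost all boundary points have exactly one parameter; edges,
  corners and singular points of the parametrizations belong to the exceptional null set. Finiteness
  of the preimage is automatic almost everywhere (Sard) and is stated because \<open>sum\<close> is \<open>0\<close> on infinite sets.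
\<close>

definition represents_boundary ::
    "nat \<Rightarrow> (nat \<Rightarrow> (real^'k) set) \<Rightarrow> (nat \<Rightarrow> real^'k \<Rightarrow> real^'k option) \<Rightarrow>
     (real^'k option) set \<Rightarrow> bool" where
  "represents_boundary m D s R \<longleftrightarrow>
     (\<forall>i\<in>{1..m}. patch (D i) (s i)) \<and>
     (\<Union>i\<in>{1..m}. s i ` D i) = frontier R \<and>
     (\<exists>E. hausdorff_null CARD('k) E \<and>
        (\<forall>p \<in> frontier R - E. \<exists>\<nu>. outward_unit_normal R p \<nu> \<and>
           (\<forall>i\<in>{1..m}. finite {t \<in> D i. s i t = p}) \<and>
           (\<Sum>i=1..m. \<Sum>t | t \<in> D i \<and> s i t = p. sgn (normal_vec (s i) t \<bullet> \<nu>)) = 1))"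

definition scaling_map ::
    "real^'k option \<Rightarrow> (real^'k \<Rightarrow> real^'k option) \<Rightarrow> real \<Rightarrow> real^'k \<Rightarrow> real^'k option" where
  "scaling_map x0 s \<rho> t = x0 + \<rho> *\<^sub>R (s t - x0)"

definition scaling_jacobian ::
    "real^'k option \<Rightarrow> (real^'k \<Rightarrow> real^'k option) \<Rightarrow> real \<Rightarrow> real^'k \<Rightarrow> real" where
  "scaling_jacobian x0 s \<rho> t = \<rho> ^ CARD('k) * tangent_det s t (s t - x0)"

definition scaled_region ::
    "nat \<Rightarrow> (nat \<Rightarrow> (real^'k) set) \<Rightarrow> (nat \<Rightarrow> real^'k \<Rightarrow> real^'k option) \<Rightarrow> real^'k option \<Rightarrow>
     (real^'k option) set" where
  "scaled_region m D s x0 =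
     (\<Union>i\<in>{1..m}. {scaling_map x0 (s i) \<rho> t | \<rho> t. \<rho> \<in> {0..1} \<and> t \<in> D i})"

end

theory Submission
  imports Defs
begin

text \<open>
  Both sides are integrals of \<open>f\<close> against an integer-valued weight. By an area formula with signs (local
  injectivity where the Jacobian is nonzero, Sard's lemma elsewhere) the right-hand side equals
  \<open>\<integral> f(x) n(x) dx\<close>, where \<open>n(x)\<close> counts the parameters \<open>(\<rho>, t)\<close> mapped to \<open>x\<close> with the sign of the
  Jacobian. These parameters correspond to the boundary points \<open>p = x0 + l (x - x0)\<close>, \<open>l > 1\<close>, on the ray
  from \<open>x0\<close> beyond \<open>x\<close>, together with their patch parameters. For almost every \<open>x\<close> the ray avoids the
  exceptional set (the cone over a set of \<open>(d-1)\<close>-dimensional Hausdorff measure zero is Lebesgue null)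
  and crosses the boundary transversally and finitely often. Since the oriented multiplicity is 1,
  each \<open>p\<close> contributes \<open>+1\<close> if the ray leaves \<open>R\<close> at \<open>p\<close> and \<open>-1\<close> if it enters, so \<open>n\<close> is the
  indicator of \<open>R\<close>.
\<close>

text \<open>The signs are governed by a factorization. At a boundary point
  \<open>p = x0 + l v\<close> with outward normal \<open>\<nu>\<close>, a patch parametrized near
  \<open>p\<close> stays in the boundary and is therefore tangent to the level surface there, so its
  determinant on \<open>p - x0\<close> is \<open>normal_vec \<bullet> \<nu>\<close> times
  \<open>l (\<nu> \<bullet> v)\<close>. The first factor is the orientation of the patch, the second
  the direction in which the ray crosses. Summing the signs over all parameters of \<open>p\<close>
  replaces the first factor by the multiplicity 1, whatever folds the parametrizations have.
  Transversality needs no separate argument: a ray tangent to the boundary would give a vanishing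
  Jacobian, and the image of such parameters is null. Transversal crossings are isolated, so
  compactness makes them finite in number. The boundary is regular only up to a small set in surface
  measure, whereas the exceptional points have to be null in volume. Coning raises the dimension by
  one: a set of diameter \<delta> has a cone coverable by about 1/\<delta> balls of radius
  proportional to \<delta>, hence of volume proportional to \<delta> to the power d-1.\<close>

section \<open>Coordinate isomorphisms\<close>

text \<open>The library states Sard's lemma and the change of variables formula only for well-ordered index
  types. The copy of a finite type below supplies the order.\<close>

typedef (overloaded) 'k idx = "{..<CARD('k::finite)}"
  by (rule exI [of _ 0]) simp

instantiation idx :: (finite) wellorder
begin

definition less_eq_idx :: "'a idx \<Rightarrow> 'a idx \<Rightarrow> bool" where
  "less_eq_idx x y \<longleftrightarrow> Rep_idx x \<le> Rep_idx y"

definition less_idx :: "'a idx \<Rightarrow> 'a idx \<Rightarrow> bool" where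
  "less_idx x y \<longleftrightarrow> Rep_idx x < Rep_idx y"

instance
proof
  fix x y z :: "'a idx"
  show "x < y \<longleftrightarrow> x \<le> y \<and> \<not> y \<le> x" "x \<le> x" "x \<le> y \<or> y \<le> x"
    unfolding less_eq_idx_def less_idx_def by linarith+
  show "x \<le> y \<Longrightarrow> y \<le> z \<Longrightarrow> x \<le> z"
    unfolding less_eq_idx_def by linarith
  show "x \<le> y \<Longrightarrow> y \<le> x \<Longrightarrow> x = y"
    unfolding less_eq_idx_def Rep_idx_inject [symmetric] by linarith
next
  fix P :: "'a idx \<Rightarrow> bool" and a
  assume step: "\<And>x. (\<And>y. y < x \<Longrightarrow> P y) \<Longrightarrow> P x"
  show "P a"
  proof (induction "Rep_idx a" arbitrary: a rule: less_induct)
    case less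
    show ?case by (rule step, rule less) (simp add: less_idx_def)
  qed
qed

end

instance idx :: (finite) finite
proof
  show "finite (UNIV :: 'a idx set)"
    using type_definition.Abs_image [OF type_definition_idx] by (metis finite_imageI finite_lessThan)
qed

lemma card_idx: "CARD('k::finite idx) = CARD('k)"
  by (simp add: type_definition.card [OF type_definition_idx])

text \<open>Relabelling of coordinates between Euclidean spaces of different types. Such a map is
  orthogonal and preserves Lebesgue measure, so it can carry statements from \<open>real^'w\<close>
  with ordered \<open>'w\<close> to \<open>real \<times> (real^'k)\<close> and
  \<open>real^'k option\<close>.\<close>

definition basis_iso :: "('a::euclidean_space \<Rightarrow> 'b::euclidean_space) \<Rightarrow> bool" where
  "basis_iso T \<longleftrightarrow> linear T \<and> bij_betw T Basis Basis"

lemma basis_iso_inner: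
  assumes "basis_iso T" "b \<in> Basis"
  shows "T x \<bullet> T b = x \<bullet> b"
proof -
  have lin: "linear T" and bij: "bij_betw T Basis Basis"
    using assms by (auto simp: basis_iso_def)
  have "T x \<bullet> T b = (\<Sum>c\<in>Basis. (x \<bullet> c) *\<^sub>R T c) \<bullet> T b"
    by (simp add: linear_sum [OF lin, symmetric] linear_scale [OF lin, symmetric]
        euclidean_representation)
  also have "\<dots> = (\<Sum>c\<in>Basis. (x \<bullet> c) * (if c = b then 1 else 0))"
    unfolding inner_sum_left inner_scaleR_left
  proof (intro sum.cong refl)
    fix c :: 'a assume c: "c \<in> Basis"
    have "T c \<in> Basis" "T b \<in> Basis" "T c = T b \<longleftrightarrow> c = b"
      using bij c assms(2) by (auto simp: bij_betw_def inj_on_def)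
    then show "(x \<bullet> c) * (T c \<bullet> T b) = (x \<bullet> c) * (if c = b then 1 else 0)"
      by (simp add: inner_Basis)
  qed
  also have "\<dots> = (\<Sum>c\<in>Basis. if c = b then x \<bullet> c else 0)"
    by (intro sum.cong) auto
  also have "\<dots> = x \<bullet> b" using assms(2) by (simp add: sum.delta')
  finally show ?thesis .
qed

lemma basis_iso_inverse:
  assumes "basis_iso T"
  obtains T' where "basis_iso T'" "\<And>x. T' (T x) = x" "\<And>y. T (T' y) = y"
proof -
  have lin: "linear T" and bij: "bij_betw T Basis Basis"
    using assms by (auto simp: basis_iso_def)
  \<comment> \<open>\<open>T\<close> is orthogonal, so its inverse is its adjoint: the coordinates
    of \<open>y\<close> along the images \<open>T b\<close>.\<close>
  define T' where "T' y = (\<Sum>b\<in>Basis. (y \<bullet> T b) *\<^sub>R b)" for y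
  have 1: "T' (T x) = x" for x
  proof -
    have "T' (T x) = (\<Sum>b\<in>Basis. (x \<bullet> b) *\<^sub>R b)"
      unfolding T'_def by (intro sum.cong refl) (simp add: basis_iso_inner [OF assms])
    then show ?thesis by (simp add: euclidean_representation)
  qed
  have 2: "T (T' y) = y" for y
  proof -
    have "T (T' y) = (\<Sum>b\<in>Basis. (y \<bullet> T b) *\<^sub>R T b)"
      unfolding T'_def by (simp add: linear_sum [OF lin] linear_scale [OF lin])
    also have "\<dots> = (\<Sum>b\<in>Basis. (y \<bullet> b) *\<^sub>R b)"
      by (rule sum.reindex_bij_betw [OF bij])
    finally show ?thesis by (simp add: euclidean_representation)
  qed
  have "linear T'"
    unfolding T'_def by (rule linearI)
      (simp_all add: inner_add_left scaleR_add_left sum.distrib scaleR_sum_right)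
  moreover have "bij_betw T' Basis Basis"
  proof (rule bij_betwI [where g = T])
    show "T' \<in> Basis \<rightarrow> Basis"
    proof
      fix x :: 'b assume "x \<in> Basis"
      then obtain b where "b \<in> Basis" "x = T b" using bij by (auto simp: bij_betw_def)
      then show "T' x \<in> Basis" using 1 by simp
    qed
    show "T \<in> Basis \<rightarrow> Basis" using bij by (auto simp: bij_betw_def)
  qed (simp_all add: 1 2)
  ultimately show ?thesis
    using 1 2 that [of T'] by (auto simp: basis_iso_def)
qed

lemma basis_iso_measurable_lborel:
  assumes "basis_iso T"
  shows "T \<in> borel \<rightarrow>\<^sub>M borel"
  using assms by (auto simp: basis_iso_def intro!: borel_measurable_continuous_onI
        linear_continuous_on linear_conv_bounded_linear [THEN iffD1])

text \<open>Boxes pull back to boxes with the same side lengths in another order, and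
  \<open>lborel\<close> is determined by its values on boxes.\<close>

lemma basis_iso_distr_lborel:
  assumes "basis_iso T"
  shows "distr lborel borel T = lborel"
proof (rule lborel_eqI [symmetric])
  have bij: "bij_betw T Basis Basis" using assms by (auto simp: basis_iso_def)
  obtain T' where T': "basis_iso T'" "\<And>x. T' (T x) = x" "\<And>y. T (T' y) = y"
    by (rule basis_iso_inverse [OF assms]) blast
  note meas = basis_iso_measurable_lborel [OF assms]
  fix l u :: 'b
  assume le: "\<And>b. b \<in> Basis \<Longrightarrow> l \<bullet> b \<le> u \<bullet> b"
  have inn: "T' y \<bullet> b = y \<bullet> T b" if "b \<in> Basis" for y b
    using basis_iso_inner [OF assms that, of "T' y"] by (simp add: T')
  have inn': "x \<bullet> b = T x \<bullet> T b" if "b \<in> Basis" for x b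
    using basis_iso_inner [OF assms that, of "x"] by simp
  have eq: "T -` box l u = box (T' l) (T' u)"
  proof (rule set_eqI)
    fix x
    have "x \<in> T -` box l u \<longleftrightarrow> (\<forall>c\<in>T ` Basis. l \<bullet> c < T x \<bullet> c \<and> T x \<bullet> c < u \<bullet> c)"
      using bij by (simp add: box_def bij_betw_def)
    also have "\<dots> \<longleftrightarrow> x \<in> box (T' l) (T' u)"
      by (simp add: box_def inn inn' [symmetric])
    finally show "x \<in> T -` box l u \<longleftrightarrow> x \<in> box (T' l) (T' u)" .
  qed
  have "emeasure (distr lborel borel T) (box l u) = emeasure lborel (box (T' l) (T' u))"
    using meas by (subst emeasure_distr) (auto simp: eq)
  also have "\<dots> = (\<Prod>b\<in>Basis. (u - l) \<bullet> T b)"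
  proof (subst emeasure_lborel_box)
    show "T' l \<bullet> b \<le> T' u \<bullet> b" if "b \<in> Basis" for b
      using le [of "T b"] bij that by (simp add: inn bij_betw_def image_iff) blast
    show "ennreal (\<Prod>b\<in>Basis. (T' u - T' l) \<bullet> b) = ennreal (\<Prod>b\<in>Basis. (u - l) \<bullet> T b)"
      by (intro arg_cong [where f = ennreal] prod.cong refl) (simp add: inner_diff_left inn)
  qed
  also have "(\<Prod>b\<in>Basis. (u - l) \<bullet> T b) = (\<Prod>b\<in>Basis. (u - l) \<bullet> b)"
    by (rule prod.reindex_bij_betw [OF bij])
  finally show "emeasure (distr lborel borel T) (box l u) = (\<Prod>b\<in>Basis. (u - l) \<bullet> b)" .
qed simp

text \<open>Between completed measures Borel measurability is not enough: preimages of null sets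
  must be null too, which follows from the preservation of \<open>lborel\<close>.\<close>

lemma basis_iso_measurable_lebesgue:
  assumes "basis_iso T"
  shows "T \<in> lebesgue \<rightarrow>\<^sub>M lebesgue"
proof (rule completion.measurable_completion2)
  show "T \<in> lebesgue \<rightarrow>\<^sub>M lborel"
    using basis_iso_measurable_lborel [OF assms] by (simp add: measurable_completion)
  show "null_sets lborel \<subseteq> null_sets (distr lebesgue lborel T)"
  proof
    fix A :: "'b set" assume A: "A \<in> null_sets lborel"
    then have "A \<in> null_sets (distr lborel borel T)"
      using basis_iso_distr_lborel [OF assms] by simp
    then show "A \<in> null_sets (distr lebesgue lborel T)"
      using basis_iso_measurable_lborel [OF assms] by (auto simp: null_sets_distr_iff
          measurable_completion null_sets_completionI)
  qed
qed

lemma basis_iso_distr_lebesgue: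
  assumes "basis_iso T"
  shows "distr lebesgue lebesgue T = lebesgue"
proof -
  note lb = basis_iso_distr_lborel [OF assms]
  have meas: "T \<in> lebesgue \<rightarrow>\<^sub>M lborel"
    using basis_iso_measurable_lborel [OF assms] by (simp add: measurable_completion)
  have eq: "distr lebesgue lborel T = lborel"
  proof (rule measure_eqI)
    fix A assume "A \<in> sets (distr lebesgue lborel T)"
    then have A: "A \<in> sets borel" by simp
    have "emeasure (distr lebesgue lborel T) A = emeasure lebesgue (T -` A)"
      using emeasure_distr [OF meas, of A] A by simp
    also have "\<dots> = emeasure lborel (T -` A)"
      using measurable_sets [OF basis_iso_measurable_lborel [OF assms] A] by simp
    also have "\<dots> = emeasure (distr lborel borel T) A"
      using emeasure_distr [of T lborel borel A] A basis_iso_measurable_lborel [OF assms] by simp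
    finally show "emeasure (distr lebesgue lborel T) A = emeasure lborel A"
      by (simp add: lb)
  qed simp
  have "completion (distr lebesgue lborel T) = distr lebesgue (completion lborel) T"
    by (rule completion.completion_distr_eq [OF meas]) (simp add: eq)
  then show ?thesis by (simp add: eq)
qed

lemma basis_iso_image_vimage:
  assumes "\<And>x. T' (T x) = x" "\<And>y. T (T' y) = y"
  shows "T ` S = T' -` S"
proof (intro set_eqI iffI)
  fix y assume "y \<in> T' -` S"
  then have "T (T' y) \<in> T ` S" by blast
  then show "y \<in> T ` S" by (simp only: assms)
qed (auto simp: assms)

lemma basis_iso_integrable:
  fixes f :: "'b::euclidean_space \<Rightarrow> real"
  assumes "basis_iso T" "f absolutely_integrable_on (T ` S)"
  shows "(\<lambda>x. f (T x)) absolutely_integrable_on S"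
    and "integral S (\<lambda>x. f (T x)) = integral (T ` S) f"
proof -
  obtain T' where T': "basis_iso T'" "\<And>x. T' (T x) = x" "\<And>y. T (T' y) = y"
    by (rule basis_iso_inverse [OF assms(1)]) blast
  note meas = basis_iso_measurable_lebesgue [OF assms(1)]
  have ind: "indicator (T ` S) (T x) = (indicator S x :: real)" for x
    unfolding basis_iso_image_vimage [OF T'(2,3)] by (simp add: T'(2) indicator_def)
  have int: "integrable lebesgue (\<lambda>y. indicator (T ` S) y *\<^sub>R f y)"
    using assms(2) by (simp add: set_integrable_def)
  then have "integrable (distr lebesgue lebesgue T) (\<lambda>y. indicator (T ` S) y *\<^sub>R f y)"
    by (simp only: basis_iso_distr_lebesgue [OF assms(1)])
  from integrable_distr [OF meas this]
  show *: "(\<lambda>x. f (T x)) absolutely_integrable_on S"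
    by (simp add: set_integrable_def ind)
  have "integral\<^sup>L (distr lebesgue lebesgue T) (\<lambda>y. indicator (T ` S) y *\<^sub>R f y) =
      integral\<^sup>L lebesgue (\<lambda>x. indicator (T ` S) (T x) *\<^sub>R f (T x))"
    by (rule integral_distr [OF meas]) (use int in auto)
  then have "set_lebesgue_integral lebesgue (T ` S) f = set_lebesgue_integral lebesgue S (\<lambda>x. f (T x))"
    by (simp only: basis_iso_distr_lebesgue [OF assms(1)] set_lebesgue_integral_def ind)
  then show "integral S (\<lambda>x. f (T x)) = integral (T ` S) f"
    using * assms(2) by (simp add: set_lebesgue_integral_eq_integral)
qed

text \<open>The pattern "integrable with integral \<open>b\<close>" is that of the change of
  variables theorem, so that equivalences can be chained. The converse direction comes from the
  inverse relabelling.\<close>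

lemma basis_iso_integral_iff:
  fixes f :: "'b::euclidean_space \<Rightarrow> real"
  assumes "basis_iso T"
  shows "(\<lambda>x. f (T x)) absolutely_integrable_on S \<and> integral S (\<lambda>x. f (T x)) = b \<longleftrightarrow>
    f absolutely_integrable_on (T ` S) \<and> integral (T ` S) f = b"
proof -
  obtain T' where T': "basis_iso T'" "\<And>x. T' (T x) = x" "\<And>y. T (T' y) = y"
    by (rule basis_iso_inverse [OF assms(1)]) blast
  have "T' ` T ` S = S" by (simp add: image_image T')
  then have "f absolutely_integrable_on (T ` S)" if "(\<lambda>x. f (T x)) absolutely_integrable_on S"
    using basis_iso_integrable(1) [OF T'(1), where f = "\<lambda>x. f (T x)" and S = "T ` S"] that by (simp add: T')
  then show ?thesis using basis_iso_integrable [OF assms, where f = f and S = S] by auto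
qed

lemma basis_iso_negligible_image:
  assumes "basis_iso (T :: 'a::euclidean_space \<Rightarrow> 'b::euclidean_space)" "negligible S"
  shows "negligible (T ` S)"
proof (rule negligible_differentiable_image_negligible [OF _ assms(2)])
  show "DIM('a) \<le> DIM('b)"
    using assms(1) bij_betw_same_card [of T Basis Basis] by (simp add: basis_iso_def)
  show "T differentiable_on S"
    using assms(1) by (simp add: basis_iso_def linear_imp_differentiable_on)
qed

section \<open>Sard's lemma and change of variables in coordinates\<close>

context
  fixes A :: "real^'w::{finite,wellorder} \<Rightarrow> 'a::euclidean_space"
    and B :: "'b::euclidean_space \<Rightarrow> real^'w::{finite,wellorder}"
    and F :: "'a \<Rightarrow> 'b" and F' :: "'a \<Rightarrow> 'a \<Rightarrow> 'b" and S :: "'a set"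
  assumes A: "basis_iso A" and B: "basis_iso B"
    and deriv: "\<And>x. x \<in> S \<Longrightarrow> (F has_derivative F' x) (at x within S)"
begin

lemma conjugated_domain: "A ` (A -` S) = S"
proof -
  obtain A' where "\<And>y. A (A' y) = y" by (rule basis_iso_inverse [OF A]) blast
  then have "surj A" by (rule surjI)
  then show ?thesis by (rule surj_image_vimage_eq)
qed

lemma conjugated_derivative:
  assumes "A y \<in> S"
  shows "((B \<circ> F \<circ> A) has_derivative (B \<circ> F' (A y) \<circ> A)) (at y within A -` S)"
proof -
  have lin: "bounded_linear A" "bounded_linear B"
    using A B unfolding basis_iso_def linear_conv_bounded_linear by blast+
  have "((F \<circ> A) has_derivative (F' (A y) \<circ> A)) (at y within A -` S)"
    using deriv [OF assms] bounded_linear_imp_has_derivative [OF lin(1)]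
    by (intro diff_chain_within) (simp_all add: conjugated_domain del: image_vimage_eq)
  from has_derivative_compose [OF this bounded_linear_imp_has_derivative [OF lin(2)]]
  show ?thesis by (simp add: o_def)
qed

lemma conjugated_image: "(B \<circ> F \<circ> A) ` (A -` S) = B ` F ` S"
  by (simp only: image_comp [symmetric] conjugated_domain)

text \<open>\<open>B \<circ> F \<circ> A\<close> is a self-map of \<open>real^'w\<close> whose
  derivative has deficient rank; the inverse of \<open>B\<close> then takes the relabelling off the
  null image.\<close>

lemma conjugated_Sard:
  assumes "\<And>x. x \<in> S \<Longrightarrow> det (matrix (B \<circ> F' x \<circ> A)) = 0"
  shows "negligible (F ` S)"
proof -
  have "negligible ((B \<circ> F \<circ> A) ` (A -` S))"
  proof (rule baby_Sard)
    fix y assume "y \<in> A -` S"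
    then show "((B \<circ> F \<circ> A) has_derivative (B \<circ> F' (A y) \<circ> A)) (at y within A -` S)"
      by (intro conjugated_derivative) simp
    have "det (matrix (B \<circ> F' (A y) \<circ> A)) = 0"
      using assms \<open>y \<in> A -` S\<close> by simp
    then show "rank (matrix (B \<circ> F' (A y) \<circ> A)) < CARD('w)"
      by (simp add: det_eq_0_rank)
  qed simp
  then have neg: "negligible (B ` F ` S)" by (simp only: conjugated_image)
  obtain B' where B': "basis_iso B'" "\<And>x. B' (B x) = x" "\<And>y. B (B' y) = y"
    by (rule basis_iso_inverse [OF B]) blast
  show ?thesis
    using basis_iso_negligible_image [OF B'(1) neg] by (simp add: image_image B')
qed

text \<open>The domain is relabelled by \<open>A\<close>, the integrand is lifted to
  \<open>real^1\<close> because the underlying theorem is about vector-valued integrands, variables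
  are changed along \<open>B \<circ> F \<circ> A\<close>, and the image is relabelled back by
  \<open>B'\<close>.\<close>

lemma conjugated_change_of_variables:
  fixes h :: "'b \<Rightarrow> real"
  assumes S: "S \<in> sets lebesgue" and inj: "inj_on F S"
  shows "(\<lambda>x. \<bar>det (matrix (B \<circ> F' x \<circ> A))\<bar> * h (F x)) absolutely_integrable_on S \<and>
      integral S (\<lambda>x. \<bar>det (matrix (B \<circ> F' x \<circ> A))\<bar> * h (F x)) = b \<longleftrightarrow>
    h absolutely_integrable_on (F ` S) \<and> integral (F ` S) h = b"
proof -
  obtain A' where A': "basis_iso A'" "\<And>x. A' (A x) = x" "\<And>y. A (A' y) = y"
    by (rule basis_iso_inverse [OF A]) blast
  obtain B' where B': "basis_iso B'" "\<And>x. B' (B x) = x" "\<And>y. B (B' y) = y"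
    by (rule basis_iso_inverse [OF B]) blast
  define d where "d x = \<bar>det (matrix (B \<circ> F' x \<circ> A))\<bar>" for x
  have meas: "A -` S \<in> sets lebesgue"
    using measurable_sets [OF basis_iso_measurable_lebesgue [OF A] S] by simp
  have injH: "inj_on (B \<circ> F \<circ> A) (A -` S)"
  proof (rule inj_onI)
    fix x y assume xy: "x \<in> A -` S" "y \<in> A -` S" "(B \<circ> F \<circ> A) x = (B \<circ> F \<circ> A) y"
    then have "B' (B (F (A x))) = B' (B (F (A y)))" by simp
    then have "F (A x) = F (A y)" by (simp only: B'(2))
    then have "A x = A y" using xy inj by (auto simp: inj_on_def)
    then have "A' (A x) = A' (A y)" by simp
    then show "x = y" by (simp only: A'(2))
  qed
  have "(\<lambda>x. d x * h (F x)) absolutely_integrable_on S \<and>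
      integral S (\<lambda>x. d x * h (F x)) = b \<longleftrightarrow>
    (\<lambda>y. d (A y) * h (F (A y))) absolutely_integrable_on (A -` S) \<and>
      integral (A -` S) (\<lambda>y. d (A y) * h (F (A y))) = b"
    using basis_iso_integral_iff [OF A, where f = "\<lambda>x. d x * h (F x)" and S = "A -` S" and b = b]
    unfolding conjugated_domain by (rule sym)
  also have "\<dots> \<longleftrightarrow>
    (\<lambda>y. \<bar>det (matrix (B \<circ> F' (A y) \<circ> A))\<bar> *\<^sub>R (vec (h (B' ((B \<circ> F \<circ> A) y))) :: real^1))
        absolutely_integrable_on (A -` S) \<and>
      integral (A -` S) (\<lambda>y. \<bar>det (matrix (B \<circ> F' (A y) \<circ> A))\<bar> *\<^sub>R vec (h (B' ((B \<circ> F \<circ> A) y)))) = (vec b :: real^1)"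
    by (simp add: absolutely_integrable_on_1_iff integral_on_1_eq d_def B')
  also have "\<dots> \<longleftrightarrow> (\<lambda>z. vec (h (B' z)) :: real^1) absolutely_integrable_on ((B \<circ> F \<circ> A) ` (A -` S)) \<and>
      integral ((B \<circ> F \<circ> A) ` (A -` S)) (\<lambda>z. vec (h (B' z))) = (vec b :: real^1)"
    by (rule has_absolute_integral_change_of_variables [OF meas _ injH, of _ "\<lambda>z. vec (h (B' z))"])
      (simp add: conjugated_derivative)
  also have "\<dots> \<longleftrightarrow> (\<lambda>z. h (B' z)) absolutely_integrable_on (B ` F ` S) \<and>
      integral (B ` F ` S) (\<lambda>z. h (B' z)) = b"
    unfolding conjugated_image by (simp add: absolutely_integrable_on_1_iff integral_on_1_eq)
  also have "\<dots> \<longleftrightarrow> h absolutely_integrable_on (F ` S) \<and> integral (F ` S) h = b"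
    using basis_iso_integral_iff [OF B'(1), where f = h and S = "B ` F ` S" and b = b] by (simp add: image_image B')
  finally show ?thesis by (simp add: d_def)
qed

end

section \<open>Signed determinants for maps from \<open>real \<times> (real^'k)\<close> to
  \<open>real^'k option\<close>\<close>

text \<open>Conjugation by \<open>r\<close> is a sign-preserving bijection between the permutations
  of the two index types, so the Leibniz sums agree term by term.\<close>

lemma det_reindex:
  fixes M :: "real^'n^'n" and r :: "'w::finite \<Rightarrow> 'n::finite"
  assumes r: "bij r"
  shows "det (\<chi> i j. M $ r i $ r j) = det M"
proof -
  have permutes_UNIV_iff: "p permutes UNIV \<longleftrightarrow> bij p" for p :: "'x \<Rightarrow> 'x"
    by (auto simp: permutes_univ bij_iff permutes_bij)
  have inj: "inj r" and surj: "range r = UNIV" using r by (auto simp: bij_def)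
  have mp: "map_permutation UNIV r p = r \<circ> p \<circ> inv r" for p
    by (simp add: map_permutation_def restrict_id_def fun_eq_iff surj)
  have bij: "bij_betw (\<lambda>p. r \<circ> p \<circ> inv r) {p. p permutes UNIV} {p. p permutes UNIV}"
  proof (rule bij_betwI [where g = "\<lambda>p. inv r \<circ> p \<circ> r"])
    show "(\<lambda>p. r \<circ> p \<circ> inv r) \<in> {p. p permutes UNIV} \<rightarrow> {p. p permutes UNIV}"
      using r by (auto intro!: bij_comp bij_imp_bij_inv simp: permutes_UNIV_iff)
    show "(\<lambda>p. inv r \<circ> p \<circ> r) \<in> {p. p permutes UNIV} \<rightarrow> {p. p permutes UNIV}"
      using r by (auto intro!: bij_comp bij_imp_bij_inv simp: permutes_UNIV_iff)
  qed (use r in \<open>auto simp: fun_eq_iff bij_is_inj bij_is_surj surj_f_inv_f\<close>)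
  have "det M = (\<Sum>p | p permutes UNIV. of_int (sign (r \<circ> p \<circ> inv r)) *
      (\<Prod>i\<in>UNIV. M $ i $ (r \<circ> p \<circ> inv r) i))"
    unfolding det_def by (rule sum.reindex_bij_betw [OF bij, symmetric])
  also have "\<dots> = (\<Sum>p | p permutes UNIV. of_int (sign p) * (\<Prod>i\<in>UNIV. M $ r i $ r (p i)))"
  proof (intro sum.cong refl)
    fix p :: "'w \<Rightarrow> 'w" assume p: "p \<in> {p. p permutes UNIV}"
    have "sign (r \<circ> p \<circ> inv r) = sign p"
      using sign_map_permutation [OF inj] p by (simp add: mp)
    moreover have "(\<Prod>i\<in>UNIV. M $ i $ (r \<circ> p \<circ> inv r) i) =
        (\<Prod>i\<in>UNIV. M $ r i $ (r \<circ> p \<circ> inv r) (r i))"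
      by (rule prod.reindex_bij_betw [OF r, symmetric])
    ultimately show "of_int (sign (r \<circ> p \<circ> inv r)) * (\<Prod>i\<in>UNIV. M $ i $ (r \<circ> p \<circ> inv r) i) =
        of_int (sign p) * (\<Prod>i\<in>UNIV. M $ r i $ r (p i))"
      by (simp add: inv_f_f [OF inj])
  qed
  finally show ?thesis by (simp add: det_def)
qed

text \<open>Index \<open>None\<close> is the radial parameter \<open>\<rho>\<close>.\<close>

definition param_dir :: "'k option \<Rightarrow> real \<times> (real^'k)" where
  "param_dir c = (case c of None \<Rightarrow> (1, 0) | Some j \<Rightarrow> (0, axis j 1))"

text \<open>Domain and codomain are different spaces, so the sign depends on the chosen bases.
  Indexing columns and rows by the same type fixes it without ordering that type, and matches the
  column convention of \<open>tangent_det\<close>.\<close>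

definition jac :: "(real \<times> (real^'k) \<Rightarrow> real^'k option) \<Rightarrow> real" where
  "jac L = det (\<chi> row col. L (param_dir col) $ row)"

lemma Basis_cart: "(Basis :: (real^'n) set) = range (\<lambda>i. axis i 1)"
  by (auto simp: Basis_vec_def)

lemma bij_betw_axis: "bij_betw (\<lambda>i. axis i 1 :: real^'n) UNIV Basis"
  unfolding Basis_cart by (intro inj_on_imp_bij_betw) (auto simp: inj_on_def axis_eq_axis)

lemma bij_betw_param_dir:
  "bij_betw param_dir (UNIV :: 'k option set) (Basis :: (real \<times> (real^'k::finite)) set)"
proof -
  have "inj (param_dir :: 'k option \<Rightarrow> _)"
    by (auto simp: inj_def param_dir_def axis_eq_axis split: option.splits)
  moreover have "range (param_dir :: 'k option \<Rightarrow> _) = Basis"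
    by (auto simp: UNIV_option_conv param_dir_def Basis_prod_def Basis_cart image_image)
  ultimately show ?thesis by (simp add: bij_betw_def)
qed

lemma basis_iso_coordinates:
  fixes r :: "'w::finite \<Rightarrow> 'n::finite"
  assumes "bij r"
  shows "basis_iso (\<lambda>x :: real^'n. (\<chi> w. x $ r w) :: real^'w)"
  unfolding basis_iso_def
proof
  let ?B = "\<lambda>x :: real^'n. (\<chi> w. x $ r w) :: real^'w"
  show "linear ?B" by (rule linearI) (simp_all add: vec_eq_iff)
  have ax: "?B (axis (r w) 1) = axis w 1" for w
    using assms by (auto simp: vec_eq_iff axis_def bij_def inj_def)
  have "bij_betw (\<lambda>w. axis (r w) 1 :: real^'n) UNIV Basis"
    using bij_betw_trans [OF assms bij_betw_axis] by (simp add: o_def)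
  moreover have "bij_betw (?B \<circ> (\<lambda>w. axis (r w) 1)) UNIV Basis"
    using bij_betw_axis by (simp add: o_def ax)
  ultimately show "bij_betw ?B Basis Basis"
    using bij_betw_comp_iff [of "\<lambda>w. axis (r w) 1 :: real^'n" UNIV Basis ?B Basis] by simp
qed

lemma basis_iso_combination:
  fixes e :: "'w::finite \<Rightarrow> 'a::euclidean_space"
  assumes "bij_betw e UNIV Basis"
  shows "basis_iso (\<lambda>y :: real^'w. \<Sum>w\<in>UNIV. y $ w *\<^sub>R e w)"
    and "(\<Sum>w\<in>UNIV. axis v 1 $ w *\<^sub>R e w) = e v"
proof -
  let ?A = "\<lambda>y :: real^'w. \<Sum>w\<in>UNIV. y $ w *\<^sub>R e w"
  show ax: "?A (axis v 1) = e v" for v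
  proof -
    have "?A (axis v 1) = (\<Sum>w\<in>UNIV. if w = v then e w else 0)"
      by (intro sum.cong) (auto simp: axis_def)
    then show ?thesis by simp
  qed
  have "linear ?A"
    by (rule linearI) (simp_all add: scaleR_add_left sum.distrib scaleR_sum_right)
  moreover have "bij_betw (?A \<circ> (\<lambda>w. axis w 1)) UNIV Basis"
    using assms by (simp only: o_def ax)
  then have "bij_betw ?A Basis Basis"
    using bij_betw_comp_iff [OF bij_betw_axis, of ?A Basis] by simp
  ultimately show "basis_iso ?A" by (simp add: basis_iso_def)
qed

text \<open>A single bijection \<open>r\<close> relabels rows and columns together, so the
  determinant keeps its sign and not only its absolute value.\<close>

lemma coordinates_exist:
  obtains A :: "real^'k::finite option idx \<Rightarrow> real \<times> (real^'k)" and B :: "real^'k option \<Rightarrow> real^'k option idx"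
  where "basis_iso A" "basis_iso B" "\<And>L. det (matrix (B \<circ> L \<circ> A)) = jac L"
proof -
  have "card (UNIV :: 'k option idx set) = card (UNIV :: 'k option set)" by (rule card_idx)
  then obtain r :: "'k option idx \<Rightarrow> 'k option" where r: "bij r"
    using finite_same_card_bij [of "UNIV :: 'k option idx set" "UNIV :: 'k option set"] by auto
  define A :: "real^'k option idx \<Rightarrow> real \<times> (real^'k)" where
    "A y = (\<Sum>w\<in>UNIV. y $ w *\<^sub>R param_dir (r w))" for y
  define B :: "real^'k option \<Rightarrow> real^'k option idx" where "B x = (\<chi> w. x $ r w)" for x
  have e: "bij_betw (\<lambda>w. param_dir (r w)) UNIV (Basis :: (real \<times> (real^'k)) set)"
    using bij_betw_trans [OF r bij_betw_param_dir] by (simp add: o_def)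
  have "det (matrix (B \<circ> L \<circ> A)) = jac L" for L
  proof -
    have "matrix (B \<circ> L \<circ> A) =
        (\<chi> i j. (\<chi> row col. L (param_dir col) $ row) $ r i $ r j)"
      by (simp add: matrix_def A_def B_def basis_iso_combination(2) [OF e] vec_eq_iff)
    then show ?thesis unfolding jac_def by (simp only: det_reindex [OF r])
  qed
  moreover have "basis_iso A" unfolding A_def by (rule basis_iso_combination(1) [OF e])
  moreover have "basis_iso B" unfolding B_def by (rule basis_iso_coordinates [OF r])
  ultimately show ?thesis using that by blast
qed

context
  fixes F :: "real \<times> (real^'k::finite) \<Rightarrow> real^'k option"
    and F' :: "real \<times> (real^'k) \<Rightarrow> real \<times> (real^'k) \<Rightarrow> real^'k option" and S
  assumes deriv: "\<And>x. x \<in> S \<Longrightarrow> (F has_derivative F' x) (at x within S)"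
begin

lemma Sard_jac:
  assumes "\<And>x. x \<in> S \<Longrightarrow> jac (F' x) = 0"
  shows "negligible (F ` S)"
proof -
  obtain A :: "real^'k option idx \<Rightarrow> real \<times> (real^'k)" and B :: "real^'k option \<Rightarrow> real^'k option idx"
    where "basis_iso A" "basis_iso B" "\<And>L. det (matrix (B \<circ> L \<circ> A)) = jac L"
    by (rule coordinates_exist) blast
  then show ?thesis using conjugated_Sard [OF _ _ deriv, where A = A and B = B] assms by simp
qed

lemma change_of_variables_jac:
  fixes h :: "real^'k option \<Rightarrow> real"
  assumes "S \<in> sets lebesgue" "inj_on F S"
  shows "(\<lambda>x. \<bar>jac (F' x)\<bar> * h (F x)) absolutely_integrable_on S \<and>
      integral S (\<lambda>x. \<bar>jac (F' x)\<bar> * h (F x)) = b \<longleftrightarrow>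
    h absolutely_integrable_on (F ` S) \<and> integral (F ` S) h = b"
proof -
  obtain A :: "real^'k option idx \<Rightarrow> real \<times> (real^'k)" and B :: "real^'k option \<Rightarrow> real^'k option idx"
    where AB: "basis_iso A" "basis_iso B" "\<And>L. det (matrix (B \<circ> L \<circ> A)) = jac L"
    by (rule coordinates_exist) blast
  show ?thesis
    using conjugated_change_of_variables [OF AB(1,2) deriv assms, where h = h and b = b]
    by (simp only: AB(3))
qed

end

section \<open>A signed area formula\<close>

lemma continuous_on_jac:
  assumes "\<And>v. continuous_on G (\<lambda>y. F' y v)"
  shows "continuous_on G (\<lambda>y. jac (F' y))"
  unfolding jac_def det_def by (intro continuous_intros) (simp, intro continuous_intros assms)

lemma continuous_on_tendsto_nhds:
  fixes f :: "'a::t2_space \<Rightarrow> 'b::topological_space"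
  assumes "continuous_on G f" "open G" "a \<in> G"
  shows "(f \<longlongrightarrow> f a) (nhds a)"
proof -
  have "f \<midarrow>a\<rightarrow> f a"
    using assms continuous_on_eq_continuous_at [OF assms(2), of f] by (simp add: isCont_def)
  then show ?thesis by (simp only: tendsto_at_iff_tendsto_nhds)
qed

lemma jac_nonzero_inj:
  fixes L :: "real \<times> (real^'k::finite) \<Rightarrow> real^'k option"
  assumes "jac L \<noteq> 0" "linear L"
  shows "inj L"
proof -
  obtain A :: "real^'k option idx \<Rightarrow> real \<times> (real^'k)" and B :: "real^'k option \<Rightarrow> real^'k option idx"
    where AB: "basis_iso A" "basis_iso B" "\<And>L. det (matrix (B \<circ> L \<circ> A)) = jac L"
    by (rule coordinates_exist) blast
  obtain A' where A': "\<And>y. A (A' y) = y" by (rule basis_iso_inverse [OF AB(1)]) blast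
  have "linear (B \<circ> L \<circ> A)"
    using AB(1,2) assms(2) by (auto simp: basis_iso_def intro!: linear_compose)
  then have inj: "inj (B \<circ> L \<circ> A)"
    using det_nz_iff_inj assms(1) AB(3) by metis
  show ?thesis
  proof (rule injI)
    fix x y assume "L x = L y"
    then have "(B \<circ> L \<circ> A) (A' x) = (B \<circ> L \<circ> A) (A' y)" by (simp add: A')
    then have "A' x = A' y" using inj by (simp only: inj_eq)
    then show "x = y" by (metis A')
  qed
qed

text \<open>\<open>Ck_on\<close> gives continuity of the derivative for each fixed direction only,
  while local injectivity needs it in operator norm. In finite dimension the operator norm is
  bounded by the sum of the norms on the basis vectors.\<close>

lemma onorm_tendsto_0:
  fixes F' :: "'a::euclidean_space \<Rightarrow> 'a \<Rightarrow> 'b::euclidean_space"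
  assumes "open G" "a \<in> G" "\<And>v. continuous_on G (\<lambda>y. F' y v)"
    and "\<And>y. y \<in> G \<Longrightarrow> linear (F' y)" "e > 0"
  shows "\<exists>d>0. \<forall>x. dist a x < d \<longrightarrow> onorm (\<lambda>v. F' x v - F' a v) < e"
proof -
  let ?q = "\<lambda>x. \<Sum>b\<in>Basis. norm (F' x b - F' a b)"
  have "continuous_on G ?q" by (intro continuous_intros assms)
  then have "(?q \<longlongrightarrow> ?q a) (nhds a)"
    by (rule continuous_on_tendsto_nhds) (use assms in auto)
  then have "\<forall>\<^sub>F x in nhds a. dist (?q x) (?q a) < e"
    using assms(5) by (rule tendstoD)
  moreover have "\<forall>\<^sub>F x in nhds a. x \<in> G" using assms by (simp add: eventually_nhds_in_open)
  ultimately have "\<forall>\<^sub>F x in nhds a. onorm (\<lambda>v. F' x v - F' a v) < e"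
  proof eventually_elim
    case (elim x)
    have lin: "linear (\<lambda>v. F' x v - F' a v)"
      using assms(2,4) elim by (auto intro: linear_compose_sub)
    have "onorm (\<lambda>v. F' x v - F' a v) \<le> ?q x"
    proof (rule onorm_bound)
      fix v
      have "F' x v - F' a v = (\<Sum>b\<in>Basis. (v \<bullet> b) *\<^sub>R (F' x b - F' a b))"
        using linear_sum [OF lin, of "\<lambda>b. (v \<bullet> b) *\<^sub>R b" Basis] linear_scale [OF lin]
        by (simp add: euclidean_representation)
      also have "norm \<dots> \<le> (\<Sum>b\<in>Basis. norm ((v \<bullet> b) *\<^sub>R (F' x b - F' a b)))"
        by (rule norm_sum)
      also have "\<dots> \<le> (\<Sum>b\<in>Basis. norm v * norm (F' x b - F' a b))"
        by (intro sum_mono) (simp add: mult_right_mono Basis_le_norm)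
      finally show "norm (F' x v - F' a v) \<le> ?q x * norm v"
        by (simp add: sum_distrib_left mult.commute)
    qed (simp add: sum_nonneg)
    moreover have "?q x < e" using elim by (simp add: dist_real_def abs_less_iff)
    ultimately show ?case by simp
  qed
  then show ?thesis by (simp add: eventually_nhds_metric dist_commute)
qed

lemma indicator_disjoint_sums:
  fixes c :: real
  assumes "disjoint_family A" "y \<in> (\<Union>n. A n)"
  shows "(\<lambda>n. indicator (A n) y * c) sums c"
proof -
  obtain n where n: "y \<in> A n" using assms(2) by blast
  have "indicator (A k) y = (if k = n then 1 else 0 :: real)" for k
    using assms(1) n by (auto simp: disjoint_family_on_def indicator_def)
  then have "(\<lambda>k. indicator (A k) y * c) = (\<lambda>k. if k = n then c else 0)"
    by (simp add: fun_eq_iff)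
  then show ?thesis using sums_single [of n "\<lambda>_. c"] by simp
qed

text \<open>The partial sums of the integrals of \<open>\<bar>g\<bar>\<close> stay below its
  integral over the union; this absolute convergence is what allows integration term by
  term.\<close>

lemma integral_disjoint_sums:
  fixes g :: "'a::euclidean_space \<Rightarrow> real"
  assumes disj: "disjoint_family A" and A: "\<And>n. A n \<in> sets lebesgue"
    and g: "g absolutely_integrable_on (\<Union>n. A n)"
  shows "summable (\<lambda>n. integral (A n) (\<lambda>y. \<bar>g y\<bar>))"
    and "(\<lambda>n. integral (A n) g) sums integral (\<Union>n. A n) g"
proof -
  let ?G = "\<Union>n. A n"
  have gA: "g absolutely_integrable_on (A n)" for n
    using set_integrable_subset [OF g A] by blast
  have gA': "(\<lambda>y. \<bar>g y\<bar>) absolutely_integrable_on (A n)" for n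
    using gA by (rule set_integrable_abs)
  have eq: "integral (A n) g = (\<integral>y. indicator (A n) y * g y \<partial>lebesgue)" for n
    using set_lebesgue_integral_eq_integral(2) [OF gA] by (simp add: set_lebesgue_integral_def)
  have eq': "integral (A n) (\<lambda>y. \<bar>g y\<bar>) = (\<integral>y. norm (indicator (A n) y * g y) \<partial>lebesgue)" for n
    using set_lebesgue_integral_eq_integral(2) [OF gA']
    by (simp add: set_lebesgue_integral_def abs_mult)
  have eqG: "integral ?G g = (\<integral>y. indicator ?G y * g y \<partial>lebesgue)"
    using set_lebesgue_integral_eq_integral(2) [OF g] by (simp add: set_lebesgue_integral_def)
  have int: "integrable lebesgue (\<lambda>y. indicator (A n) y * g y)" for n
    using gA by (simp add: set_integrable_def)
  have intG: "integrable lebesgue (\<lambda>y. indicator ?G y * g y)"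
    using g by (simp add: set_integrable_def)
  have pw: "(\<lambda>n. indicator (A n) y * c) sums (indicator ?G y * c)" for y and c :: real
  proof (cases "y \<in> ?G")
    case True
    then show ?thesis using indicator_disjoint_sums [OF disj True] by simp
  next
    case False
    then have "(\<lambda>n. indicator (A n) y * c) = (\<lambda>n. 0)" by (auto simp: fun_eq_iff)
    then show ?thesis using False by simp
  qed
  have pwn: "(\<lambda>n. norm (indicator (A n) y * g y)) sums norm (indicator ?G y * g y)" for y
    using pw [of y "\<bar>g y\<bar>"] by (simp add: abs_mult)
  have "summable (\<lambda>n. \<integral>y. norm (indicator (A n) y * g y) \<partial>lebesgue)"
  proof (rule summableI_nonneg_bounded)
    fix n
    have "(\<Sum>i<n. \<integral>y. norm (indicator (A i) y * g y) \<partial>lebesgue) =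
        (\<integral>y. (\<Sum>i<n. norm (indicator (A i) y * g y)) \<partial>lebesgue)"
      by (rule Bochner_Integration.integral_sum [symmetric]) (intro integrable_norm int)
    also have "\<dots> \<le> (\<integral>y. norm (indicator ?G y * g y) \<partial>lebesgue)"
    proof (rule integral_mono)
      show "(\<Sum>i<n. norm (indicator (A i) y * g y)) \<le> norm (indicator ?G y * g y)" for y
        using sum_le_suminf [OF sums_summable [OF pwn], of "{..<n}" y] sums_unique [OF pwn, of y]
        by simp
    qed (use int intG in \<open>auto intro!: Bochner_Integration.integrable_sum\<close>)
    finally show "(\<Sum>i<n. \<integral>y. norm (indicator (A i) y * g y) \<partial>lebesgue) \<le>
        (\<integral>y. norm (indicator ?G y * g y) \<partial>lebesgue)" .
  qed simp
  then show sm: "summable (\<lambda>n. integral (A n) (\<lambda>y. \<bar>g y\<bar>))" by (simp add: eq')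
  have "(\<lambda>n. \<integral>y. indicator (A n) y * g y \<partial>lebesgue) sums
      (\<integral>y. (\<Sum>n. indicator (A n) y * g y) \<partial>lebesgue)"
    by (rule sums_integral [OF int]) (use sm sums_summable [OF pwn] in \<open>simp_all add: eq'\<close>)
  also have "(\<lambda>y. \<Sum>n. indicator (A n) y * g y) = (\<lambda>y. indicator ?G y * g y)"
    using sums_unique [OF pw] by (simp add: fun_eq_iff)
  finally show "(\<lambda>n. integral (A n) g) sums integral ?G g" by (simp add: eq eqG)
qed

context
  fixes F :: "real \<times> (real^'k::finite) \<Rightarrow> real^'k option"
    and F' :: "real \<times> (real^'k) \<Rightarrow> real \<times> (real^'k) \<Rightarrow> real^'k option" and G
  assumes openG: "open G"
    and deriv: "\<And>y. y \<in> G \<Longrightarrow> (F has_derivative F' y) (at y)"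
    and cont: "\<And>v. continuous_on G (\<lambda>y. F' y v)"
    and nonzero: "\<And>y. y \<in> G \<Longrightarrow> jac (F' y) \<noteq> 0"
begin

text \<open>A nonzero determinant makes the derivative injective, hence left invertible, and the
  inverse function argument applies near \<open>a\<close>. The constant sign lets the absolute value
  in the change of variables formula be replaced by a signed factor.\<close>

lemma local_injectivity:
  assumes "a \<in> G"
  shows "\<exists>U c. open U \<and> a \<in> U \<and> U \<subseteq> G \<and> inj_on F U \<and> (\<forall>y\<in>U. sgn (jac (F' y)) = c)"
proof -
  have lin: "linear (F' y)" if "y \<in> G" for y
    using deriv [OF that] by (rule has_derivative_linear)
  obtain g where g: "linear g" "g \<circ> F' a = id"
    using linear_injective_left_inverse [OF lin] jac_nonzero_inj [OF nonzero lin] assms by blast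
  obtain r where r: "r > 0" "ball a r \<subseteq> G" "inj_on F (ball a r)"
    by (rule has_derivative_locally_injective [OF assms openG _ g(2) deriv])
       (use g onorm_tendsto_0 [OF openG assms cont lin] in
         \<open>auto simp: linear_conv_bounded_linear\<close>)
  have "((\<lambda>y. jac (F' y)) \<longlongrightarrow> jac (F' a)) (nhds a)"
    by (rule continuous_on_tendsto_nhds [OF continuous_on_jac [OF cont] openG assms])
  \<comment> \<open>A deviation smaller than the absolute value at \<open>a\<close> cannot change
    the sign.\<close>
  then have "\<forall>\<^sub>F y in nhds a. dist (jac (F' y)) (jac (F' a)) < \<bar>jac (F' a)\<bar>"
    by (rule tendstoD) (simp add: nonzero [OF assms])
  then have "\<forall>\<^sub>F y in nhds a. sgn (jac (F' y)) = sgn (jac (F' a))"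
    by eventually_elim (auto simp: dist_real_def sgn_if abs_if split: if_splits)
  then obtain V where V: "open V" "a \<in> V" "\<forall>y\<in>V. sgn (jac (F' y)) = sgn (jac (F' a))"
    unfolding eventually_nhds by blast
  have "inj_on F (ball a r \<inter> V)" using r(3) by (rule inj_on_subset) blast
  moreover have "open (ball a r \<inter> V)" "a \<in> ball a r \<inter> V" "ball a r \<inter> V \<subseteq> G"
    using r V(1,2) by auto
  ultimately show ?thesis using V(3) by blast
qed

lemma countable_injective_partition:
  obtains A c where "disjoint_family (A :: nat \<Rightarrow> _)" "(\<Union>n. A n) = G"
    "\<And>n. A n \<in> sets lebesgue" "\<And>n. inj_on F (A n)"
    "\<And>n y. y \<in> A n \<Longrightarrow> sgn (jac (F' y)) = c n"
proof -
  define \<U> where "\<U> = {U. open U \<and> U \<subseteq> G \<and> inj_on F U \<and> (\<exists>c. \<forall>y\<in>U. sgn (jac (F' y)) = c)}"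
  have "\<Union>\<U> = G" using local_injectivity unfolding \<U>_def by blast
  moreover obtain \<V> where \<V>: "\<V> \<subseteq> \<U>" "countable \<V>" "\<Union>\<V> = \<Union>\<U>"
    by (rule Lindelof [of \<U>]) (auto simp: \<U>_def)
  ultimately have \<V>G: "\<Union>(insert {} \<V>) = G" by simp
  \<comment> \<open>The empty set is inserted so that an enumeration by all natural numbers exists
    even if \<open>\<V>\<close> is empty.\<close>
  define U where "U = from_nat_into (insert {} \<V>)"
  have rng: "range U = insert {} \<V>"
    unfolding U_def using \<V>(2) by (intro range_from_nat_into) auto
  have UU: "U n \<in> \<U>" for n
  proof -
    have "U n \<in> insert {} \<V>" using rng by blast
    then show ?thesis using \<V>(1) by (auto simp: \<U>_def)
  qed
  then have "\<exists>c. \<forall>y\<in>U n. sgn (jac (F' y)) = c" for n by (auto simp: \<U>_def)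
  then obtain c where c: "\<And>n y. y \<in> U n \<Longrightarrow> sgn (jac (F' y)) = c n" by metis
  have sub: "disjointed U n \<subseteq> U n" for n by (rule disjointed_subset)
  show ?thesis
  proof (rule that [of "disjointed U" c])
    show "(\<Union>n. disjointed U n) = G" using rng \<V>G by (simp add: UN_disjointed_eq)
    have "range (disjointed U) \<subseteq> sets lebesgue"
      by (rule sets.range_disjointed_sets) (use UU in \<open>auto simp: \<U>_def\<close>)
    then show "disjointed U n \<in> sets lebesgue" for n by blast
    show "inj_on F (disjointed U n)" for n
      using UU [of n] sub [of n] by (auto simp: \<U>_def intro: inj_on_subset)
    show "sgn (jac (F' y)) = c n" if "y \<in> disjointed U n" for n y
      using c sub that by blast
  qed (rule disjoint_family_disjointed)
qed

lemma signed_area_formula: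
  fixes h :: "real^'k option \<Rightarrow> real"
  assumes int: "(\<lambda>y. h (F y) * jac (F' y)) absolutely_integrable_on G"
    and N: "negligible N" "\<And>x. x \<notin> N \<Longrightarrow> finite {y \<in> G. F y = x}"
  shows "(\<lambda>x. h x * (\<Sum>y | y \<in> G \<and> F y = x. sgn (jac (F' y)))) absolutely_integrable_on UNIV"
    and "integral UNIV (\<lambda>x. h x * (\<Sum>y | y \<in> G \<and> F y = x. sgn (jac (F' y)))) =
      integral G (\<lambda>y. h (F y) * jac (F' y))"
proof -
  let ?g = "\<lambda>y. h (F y) * jac (F' y)"
  let ?k = "\<lambda>x. h x * (\<Sum>y | y \<in> G \<and> F y = x. sgn (jac (F' y)))"
  obtain A c where A: "disjoint_family (A :: nat \<Rightarrow> _)" "(\<Union>n. A n) = G"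
    "\<And>n. A n \<in> sets lebesgue" "\<And>n. inj_on F (A n)"
    "\<And>n y. y \<in> A n \<Longrightarrow> sgn (jac (F' y)) = c n"
    by (rule countable_injective_partition) blast
  have AG: "A n \<subseteq> G" for n using A(2) by blast
  have dA: "(F has_derivative F' y) (at y within A n)" if "y \<in> A n" for n y
    using deriv that AG by (blast intro: has_derivative_at_withinI)
  have gA: "?g absolutely_integrable_on (A n)" for n
    using set_integrable_subset [OF int A(3) AG] .
  have abs_jac: "\<bar>jac (F' y)\<bar> = c n * jac (F' y)" if "y \<in> A n" for n y
    unfolding A(5) [OF that, symmetric] by (simp add: abs_sgn mult.commute)
  \<comment> \<open>On an empty piece \<open>c n\<close> is arbitrary; on any other it is the sign
    of a nonzero number.\<close>
  have c1: "c n * c n = 1 \<or> A n = {}" for n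
  proof (cases "A n = {}")
    case False
    then obtain y where y: "y \<in> A n" by blast
    then have "jac (F' y) \<noteq> 0" using AG nonzero by blast
    then show ?thesis unfolding A(5) [OF y, symmetric] by (simp add: sgn_if)
  qed simp
  have "(\<lambda>y. \<bar>jac (F' y)\<bar> * h (F y)) absolutely_integrable_on (A n)" for n
  proof -
    have "(\<lambda>y. c n * ?g y) absolutely_integrable_on (A n)"
      by (rule set_integrable_mult_right) (rule gA)
    then show ?thesis
      by (rule set_integrable_cong [THEN iffD1, rotated -1]) (auto simp: abs_jac)
  qed
  note 1 = this
  have h: "h absolutely_integrable_on (F ` A n)"
    "integral (F ` A n) h = integral (A n) (\<lambda>y. \<bar>jac (F' y)\<bar> * h (F y))" for n
    using change_of_variables_jac [OF dA A(3,4), of n h] 1 [of n] by auto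
  have "integral (F ` A n) (\<lambda>x. \<bar>h x\<bar>) = integral (A n) (\<lambda>y. \<bar>jac (F' y)\<bar> * \<bar>h (F y)\<bar>)" for n
    using change_of_variables_jac [OF dA A(3,4), of n "\<lambda>x. \<bar>h x\<bar>"] set_integrable_abs [OF h(1) [of n]]
    by auto
  then have habs: "integral (F ` A n) (\<lambda>x. \<bar>h x\<bar>) = integral (A n) (\<lambda>y. \<bar>?g y\<bar>)" for n
    by (simp add: abs_mult mult.commute)
  define \<phi> where "\<phi> n = (\<lambda>x. indicator (F ` A n) x * (c n * h x))" for n
  have int\<phi>: "integrable lebesgue (\<phi> n)" for n
    using set_integrable_mult_right [of "c n" lebesgue "F ` A n" h] h(1) [of n]
    unfolding \<phi>_def set_integrable_def by simp
  have "integral\<^sup>L lebesgue (\<phi> n) = c n * integral (F ` A n) h" for n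
    using set_lebesgue_integral_eq_integral(2) [OF h(1), of n]
    by (simp add: \<phi>_def set_lebesgue_integral_def mult.left_commute)
  also have "c n * integral (F ` A n) h = integral (A n) (\<lambda>y. c n * (c n * jac (F' y) * h (F y)))" for n
    unfolding h(2) by (subst integral_mult_right [symmetric])
      (auto intro!: integral_cong simp: abs_jac)
  also have "integral (A n) (\<lambda>y. c n * (c n * jac (F' y) * h (F y))) = integral (A n) ?g" for n
    using c1 [of n] by (auto simp: mult.assoc [symmetric] intro!: integral_cong)
  finally have I\<phi>: "integral\<^sup>L lebesgue (\<phi> n) = integral (A n) ?g" for n .
  \<comment> \<open>These norms are the integrals of the absolute integrand over disjoint pieces of
    \<open>G\<close>, hence summable, and the series of the \<open>\<phi> n\<close> may be
    integrated term by term.\<close>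
  have "(\<integral>x. norm (\<phi> n x) \<partial>lebesgue) = integral (A n) (\<lambda>y. \<bar>?g y\<bar>)" for n
  proof (cases "A n = {}")
    case False
    then have "\<bar>c n\<bar> = 1" using c1 [of n] square_eq_1_iff [of "c n"] by auto
    then have "(\<integral>x. norm (\<phi> n x) \<partial>lebesgue) = integral (F ` A n) (\<lambda>x. \<bar>h x\<bar>)"
      using set_lebesgue_integral_eq_integral(2) [OF set_integrable_abs [OF h(1)], of n]
      by (simp add: \<phi>_def set_lebesgue_integral_def abs_mult)
    then show ?thesis by (simp add: habs)
  qed (simp add: \<phi>_def)
  then have sm: "summable (\<lambda>n. \<integral>x. norm (\<phi> n x) \<partial>lebesgue)"
    using integral_disjoint_sums(1) [OF A(1,3), of ?g] int A(2) by simp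
  \<comment> \<open>By injectivity at most one point of the fibre lies in \<open>A n\<close>, so
    this sum has at most one nonzero term. Summing over \<open>n\<close> first then recovers the
    whole fibre.\<close>
  have pw: "\<phi> n x = (\<Sum>y | y \<in> G \<and> F y = x. indicator (A n) y * (h x * sgn (jac (F' y))))"
    if "x \<notin> N" for n x
  proof (cases "x \<in> F ` A n")
    case True
    then obtain z where z: "z \<in> A n" "x = F z" by blast
    have "(\<Sum>y | y \<in> G \<and> F y = x. indicator (A n) y * (h x * sgn (jac (F' y)))) =
        (\<Sum>y\<in>{z}. indicator (A n) y * (h x * sgn (jac (F' y))))"
    proof (rule sum.mono_neutral_right)
      show "finite {y \<in> G. F y = x}" using N(2) that by blast
      show "\<forall>i\<in>{y \<in> G. F y = x} - {z}. indicator (A n) i * (h x * sgn (jac (F' i))) = 0"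
        using z A(4) [of n] by (auto simp: inj_on_def indicator_def)
    qed (use z AG in auto)
    then show ?thesis using z A(5) True by (simp add: \<phi>_def mult.commute)
  next
    case False
    then have "(\<Sum>y | y \<in> G \<and> F y = x. indicator (A n) y * (h x * sgn (jac (F' y)))) = 0"
      by (intro sum.neutral) (auto simp: indicator_def)
    then show ?thesis using False by (simp add: \<phi>_def)
  qed
  have single: "(\<lambda>n. indicator (A n) y * d) sums d" if "y \<in> G" for y and d :: real
    using indicator_disjoint_sums [OF A(1)] that A(2) by blast
  have sums\<phi>: "(\<lambda>n. \<phi> n x) sums ?k x" if "x \<notin> N" for x
    unfolding pw [OF that] sum_distrib_left by (rule sums_sum) (use single in blast)
  have norms\<phi>: "summable (\<lambda>n. norm (\<phi> n x))" if "x \<notin> N" for x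
  proof (rule summable_comparison_test')
    show "summable (\<lambda>n. \<Sum>y | y \<in> G \<and> F y = x. indicator (A n) y * \<bar>h x * sgn (jac (F' y))\<bar>)"
      by (rule summable_sum) (use single in \<open>blast intro: sums_summable\<close>)
    show "norm (norm (\<phi> n x)) \<le> (\<Sum>y | y \<in> G \<and> F y = x. indicator (A n) y * \<bar>h x * sgn (jac (F' y))\<bar>)"
      if "n \<ge> 0" for n
      unfolding pw [OF \<open>x \<notin> N\<close>] real_norm_def abs_abs
      by (rule order_trans [OF sum_abs]) (simp add: abs_mult)
  qed
  have AE_N: "AE x in lebesgue. x \<notin> N"
    using N(1) by (intro AE_not_in) (simp add: negligible_iff_null_sets)
  have AEs: "AE x in lebesgue. summable (\<lambda>n. norm (\<phi> n x))"
    using AE_N by eventually_elim (rule norms\<phi>)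
  have S: "integrable lebesgue (\<lambda>x. \<Sum>n. \<phi> n x)"
    "(\<lambda>n. integral\<^sup>L lebesgue (\<phi> n)) sums (\<integral>x. (\<Sum>n. \<phi> n x) \<partial>lebesgue)"
    using integrable_suminf [OF int\<phi> AEs sm] sums_integral [OF int\<phi> AEs sm] by auto
  have S': "(\<lambda>x. \<Sum>n. \<phi> n x) absolutely_integrable_on UNIV"
    using S(1) by (simp add: set_integrable_def)
  show "?k absolutely_integrable_on UNIV"
    by (rule absolutely_integrable_spike [OF S' N(1)]) (use sums_unique [OF sums\<phi>] in auto)
  have "integral UNIV ?k = integral UNIV (\<lambda>x. \<Sum>n. \<phi> n x)"
    by (rule integral_spike [OF N(1)]) (use sums_unique [OF sums\<phi>] in auto)
  also have "\<dots> = (\<integral>x. (\<Sum>n. \<phi> n x) \<partial>lebesgue)"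
    using set_lebesgue_integral_eq_integral(2) [OF S'] by (simp add: set_lebesgue_integral_def)
  also have "\<dots> = integral G ?g"
    using S(2) integral_disjoint_sums(2) [OF A(1,3), of ?g] int A(2)
    by (simp add: I\<phi>) (blast intro: sums_unique2)
  finally show "integral UNIV ?k = integral G ?g" .
qed

end

section \<open>Cones over small sets\<close>

text \<open>The cone lies near the segment from \<open>x0\<close> to one point \<open>p0\<close> of
  \<open>C\<close>, and is covered by balls of radius \<open>(1 + B) * \<delta>\<close> around
  \<open>N + 1\<close> equally spaced points of it, with \<open>N\<close> about
  \<open>1 / \<delta>\<close>. The factor \<open>1 + 4 * B\<close> bounds
  \<open>(N + 1) * \<delta> \<le> 1 + 2 * \<delta>\<close>, by
  \<open>\<delta> \<le> 2 * B\<close>.\<close>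

lemma cone_piece:
  fixes x0 :: "'a::euclidean_space"
  assumes dim: "DIM('a) = Suc n" "n \<ge> 1" and B: "B > 0" and C: "C \<subseteq> cball x0 B"
    and \<delta>: "\<And>p q. p \<in> C \<Longrightarrow> q \<in> C \<Longrightarrow> dist p q \<le> \<delta>" "0 \<le> \<delta>" "\<delta> \<le> 2 * B"
  shows "\<exists>T \<in> sets lborel. {x0 + \<rho> *\<^sub>R (p - x0) | \<rho> p. \<rho> \<in> {0..1} \<and> p \<in> C} \<subseteq> T \<and>
    emeasure lborel T \<le> ennreal ((1 + 4 * B) * unit_ball_vol (Suc n) * (1 + B) ^ Suc n * \<delta> ^ n)"
proof (cases "C = {}")
  case True
  then show ?thesis by (intro bexI [of _ "{}"]) auto
next
  case False
  then obtain p0 where p0: "p0 \<in> C" by blast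
  show ?thesis
  \<comment> \<open>Here \<open>1 / \<delta>\<close> is the default 0 and no spacing is available.
    The required bound is 0 because \<open>n \<ge> 1\<close>; the cone is part of a segment, which
    is null in dimension at least 2.\<close>
  proof (cases "\<delta> = 0")
    case True
    have "C = {p0}" using \<delta>(1) p0 True by force
    then have sub: "{x0 + \<rho> *\<^sub>R (p - x0) | \<rho> p. \<rho> \<in> {0..1} \<and> p \<in> C} \<subseteq> closed_segment x0 p0"
      by (auto simp: closed_segment_def algebra_simps)
    have "negligible (closed_segment x0 p0)"
      using negligible_convex_interior [of "closed_segment x0 p0"] interior_closed_segment_ge2 [of x0 p0] dim
      by simp
    then have "emeasure lborel (closed_segment x0 p0) = 0"
      by (simp add: negligible_iff_null_sets null_sets_def)
    then show ?thesis using sub by (intro bexI [of _ "closed_segment x0 p0"]) auto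
  next
    case False
    then have pos: "\<delta> > 0" using \<delta>(2) by simp
    define N where "N = nat \<lceil>1 / \<delta>\<rceil>"
    have N: "1 / \<delta> \<le> real N" "real N \<le> 1 / \<delta> + 1"
      using pos unfolding N_def by (auto simp: of_nat_ceiling)
    have N0: "real N > 0" using N(1) pos by (smt (verit) divide_pos_pos)
    \<comment> \<open>Replacing \<open>p\<close> by \<open>p0\<close> costs at most
      \<open>\<delta>\<close>, and rounding \<open>\<rho>\<close> to a multiple of
      \<open>1 / N\<close> costs at most \<open>\<delta> * B\<close>.\<close>
    define r where "r = (1 + B) * \<delta>"
    define T where "T = (\<Union>i\<le>N. cball (x0 + (real i / real N) *\<^sub>R (p0 - x0)) r)"
    have "{x0 + \<rho> *\<^sub>R (p - x0) | \<rho> p. \<rho> \<in> {0..1} \<and> p \<in> C} \<subseteq> T"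
    proof
      fix x assume "x \<in> {x0 + \<rho> *\<^sub>R (p - x0) | \<rho> p. \<rho> \<in> {0..1} \<and> p \<in> C}"
      then obtain \<rho> p where x: "x = x0 + \<rho> *\<^sub>R (p - x0)" and \<rho>: "0 \<le> \<rho>" "\<rho> \<le> 1" and p: "p \<in> C"
        by auto
      define i where "i = nat \<lfloor>\<rho> * real N\<rfloor>"
      have i: "real i \<le> \<rho> * real N" "\<rho> * real N < real i + 1"
        using \<rho> N0 unfolding i_def by auto
      have "real i \<le> real N" using i(1) \<rho> N0 by (smt (verit) mult_left_le_one_le)
      then have iN: "i \<le> N" by simp
      have "\<rho> - real i / real N = (\<rho> * real N - real i) / real N"
        using N0 by (simp add: field_simps)
      then have "\<bar>\<rho> - real i / real N\<bar> \<le> 1 / real N"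
        using i N0 by (simp add: divide_right_mono)
      also have "1 / real N \<le> \<delta>" using N(1) N0 pos by (simp add: field_simps)
      finally have d: "\<bar>\<rho> - real i / real N\<bar> \<le> \<delta>" .
      have "x0 + (real i / real N) *\<^sub>R (p0 - x0) - x =
          \<rho> *\<^sub>R (p0 - p) - (\<rho> - real i / real N) *\<^sub>R (p0 - x0)"
        unfolding x by (simp add: algebra_simps)
      also have "norm \<dots> \<le> \<bar>\<rho>\<bar> * norm (p0 - p) + \<bar>\<rho> - real i / real N\<bar> * norm (p0 - x0)"
        by (metis norm_scaleR norm_triangle_ineq4)
      also have "\<dots> \<le> 1 * \<delta> + \<delta> * B"
        using \<rho> d \<delta>(1) [OF p0 p] pos C p0
        by (intro add_mono mult_mono) (auto simp: dist_norm norm_minus_commute)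
      finally have "x \<in> cball (x0 + (real i / real N) *\<^sub>R (p0 - x0)) r"
        by (simp add: r_def dist_norm algebra_simps)
      then show "x \<in> T" using iN by (auto simp: T_def)
    qed
    moreover have "T \<in> sets lborel" by (auto simp: T_def)
    moreover have "emeasure lborel T \<le> ennreal ((1 + 4 * B) * unit_ball_vol (Suc n) * (1 + B) ^ Suc n * \<delta> ^ n)"
    proof -
      have r0: "r \<ge> 0" using B pos by (simp add: r_def)
      have v0: "unit_ball_vol (real (Suc n)) \<ge> 0" by (simp add: unit_ball_vol_nonneg)
      have "emeasure lborel T \<le>
          (\<Sum>i\<le>N. emeasure lborel (cball (x0 + (real i / real N) *\<^sub>R (p0 - x0)) r))"
        unfolding T_def by (rule emeasure_subadditive_finite) auto
      also have "\<dots> = (\<Sum>i\<le>N. ennreal (unit_ball_vol (real (Suc n)) * r ^ Suc n))"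
        by (simp only: emeasure_cball [OF r0] dim(1))
      also have "\<dots> = ennreal (\<Sum>i\<le>N. unit_ball_vol (real (Suc n)) * r ^ Suc n)"
        by (rule sum_ennreal) (use v0 r0 in simp)
      also have "\<dots> \<le> ennreal ((1 + 4 * B) * unit_ball_vol (Suc n) * (1 + B) ^ Suc n * \<delta> ^ n)"
      proof (rule ennreal_leI)
        have "(\<Sum>i\<le>N. unit_ball_vol (real (Suc n)) * r ^ Suc n) =
            ((real N + 1) * \<delta>) * (unit_ball_vol (real (Suc n)) * (1 + B) ^ Suc n * \<delta> ^ n)"
          by (simp add: r_def power_mult_distrib)
        also have "\<dots> \<le> (1 + 4 * B) * (unit_ball_vol (real (Suc n)) * (1 + B) ^ Suc n * \<delta> ^ n)"
        proof (rule mult_right_mono)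
          have "(real N + 1) * \<delta> \<le> (1 / \<delta> + 2) * \<delta>"
            using N(2) pos by (intro mult_right_mono) auto
          also have "\<dots> \<le> 1 + 4 * B" using pos \<delta>(3) by (simp add: field_simps)
          finally show "(real N + 1) * \<delta> \<le> 1 + 4 * B" .
        qed (use v0 B pos in simp)
        finally show "(\<Sum>i\<le>N. unit_ball_vol (real (Suc n)) * r ^ Suc n) \<le>
            (1 + 4 * B) * unit_ball_vol (Suc n) * (1 + B) ^ Suc n * \<delta> ^ n"
          by (simp only: mult.assoc)
      qed
      finally show ?thesis .
    qed
    ultimately show ?thesis by blast
  qed
qed

text \<open>Each covering set of diameter \<delta> contributes at most \<open>K\<close> times the
  \<open>n\<close>-th power of \<delta> to the volume, so coverings with total below
  \<open>e / K\<close> suffice. Restriction to a ball is what allows one constant \<open>K\<close>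
  for all pieces.\<close>

lemma negligible_cone_hausdorff_null:
  fixes x0 :: "'a::euclidean_space"
  assumes dim: "DIM('a) = Suc n" "n \<ge> 1" and E: "hausdorff_null n E"
  shows "negligible {x0 + \<rho> *\<^sub>R (p - x0) | \<rho> p. \<rho> \<in> {0..1} \<and> p \<in> E \<inter> cball x0 B}"
    (is "negligible (?cone (E \<inter> cball x0 B))")
proof (cases "B > 0")
  case False
  then have "?cone (E \<inter> cball x0 B) \<subseteq> {x0}"
    by (auto simp: not_less) (metis dist_le_zero_iff order_trans)
  then show ?thesis using negligible_sing negligible_subset by blast
next
  case True
  define K where "K = (1 + 4 * B) * unit_ball_vol (Suc n) * (1 + B) ^ Suc n"
  have K: "K > 0" using True by (simp add: K_def)
  show ?thesis
    unfolding negligible_outer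
  proof (intro allI impI)
    fix e :: real assume e: "e > 0"
    obtain C where C: "E \<subseteq> (\<Union>j. C j)" "\<And>j. bounded (C j)"
      "summable (\<lambda>j :: nat. diameter (C j) ^ n)" "(\<Sum>j. diameter (C j) ^ n) < e / K"
      using E K e unfolding hausdorff_null_def by (meson divide_pos_pos)
    \<comment> \<open>The pieces cut down to the ball have diameter at most \<open>2 * B\<close>, as
      \<open>cone_piece\<close> demands, and no larger than before.\<close>
    define C' where "C' j = C j \<inter> cball x0 B" for j
    have bC': "bounded (C' j)" for j
      unfolding C'_def by (rule bounded_subset [OF bounded_cball]) blast
    have "\<exists>T \<in> sets lborel. ?cone (C' j) \<subseteq> T \<and> emeasure lborel T \<le> ennreal (K * diameter (C' j) ^ n)" for j
      unfolding K_def
    proof (rule cone_piece [OF dim True])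
      show "diameter (C' j) \<le> 2 * B"
        using diameter_subset [of "C' j" "cball x0 B"] True by (simp add: C'_def diameter_cball)
    qed (use bC' in \<open>auto simp: C'_def diameter_bounded_bound diameter_ge_0\<close>)
    note pieces = this
    define Q where "Q j T \<longleftrightarrow> T \<in> sets lborel \<and> ?cone (C' j) \<subseteq> T \<and>
        emeasure lborel T \<le> ennreal (K * diameter (C' j) ^ n)" for j T
    have "\<exists>T. Q j T" for j using pieces [of j] unfolding Q_def by (simp only: Bex_def)
    then obtain T where "\<And>j. Q j (T j)" by metis
    then have T: "\<And>j. T j \<in> sets lborel" "\<And>j. ?cone (C' j) \<subseteq> T j"
      "\<And>j. emeasure lborel (T j) \<le> ennreal (K * diameter (C' j) ^ n)"
      by (simp_all only: Q_def)
    have sub: "?cone (E \<inter> cball x0 B) \<subseteq> (\<Union>j. T j)"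
    proof
      fix x assume "x \<in> ?cone (E \<inter> cball x0 B)"
      then obtain \<rho> p where x: "x = x0 + \<rho> *\<^sub>R (p - x0)" "\<rho> \<in> {0..1}" "p \<in> E" "p \<in> cball x0 B"
        by blast
      then obtain j where "p \<in> C' j" using C(1) by (auto simp: C'_def)
      then have "x \<in> ?cone (C' j)" using x by blast
      then show "x \<in> (\<Union>j. T j)" using T(2) by blast
    qed
    have d0: "0 \<le> diameter (C j) ^ n" for j using C(2) by (simp add: diameter_ge_0)
    have "emeasure lborel (\<Union>j. T j) \<le> (\<Sum>j. emeasure lborel (T j))"
      by (rule emeasure_subadditive_countably) (use T(1) in auto)
    also have "\<dots> \<le> (\<Sum>j. ennreal (K * diameter (C j) ^ n))"
    proof (rule suminf_le)
      fix j
      have "diameter (C' j) ^ n \<le> diameter (C j) ^ n"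
        using C(2) bC' by (intro power_mono diameter_subset) (auto simp: C'_def diameter_ge_0)
      then have "ennreal (K * diameter (C' j) ^ n) \<le> ennreal (K * diameter (C j) ^ n)"
        using K by (intro ennreal_leI mult_left_mono) auto
      then show "emeasure lborel (T j) \<le> ennreal (K * diameter (C j) ^ n)"
        using T(3) order_trans by blast
    qed auto
    also have "\<dots> = ennreal (\<Sum>j. K * diameter (C j) ^ n)"
      by (rule suminf_ennreal2) (use K d0 C(3) in \<open>auto intro: summable_mult\<close>)
    also have "(\<Sum>j. K * diameter (C j) ^ n) = K * (\<Sum>j. diameter (C j) ^ n)"
      using C(3) by (rule suminf_mult)
    finally have le: "emeasure lborel (\<Union>j. T j) \<le> ennreal (K * (\<Sum>j. diameter (C j) ^ n))" .
    have "K * (\<Sum>j. diameter (C j) ^ n) < e" using C(4) K by (simp add: field_simps)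
    with le have lt: "emeasure lborel (\<Union>j. T j) < ennreal e"
      using e by (meson ennreal_lessI le_less_trans)
    have meas: "(\<Union>j. T j) \<in> sets lborel" using T(1) by blast
    have em: "emeasure lebesgue (\<Union>j. T j) = emeasure lborel (\<Union>j. T j)"
      using meas by simp
    show "\<exists>T. ?cone (E \<inter> cball x0 B) \<subseteq> T \<and> T \<in> lmeasurable \<and> measure lebesgue T < e"
    proof (intro exI conjI)
      show "?cone (E \<inter> cball x0 B) \<subseteq> (\<Union>j. T j)" by (rule sub)
      show "(\<Union>j. T j) \<in> lmeasurable"
      proof (rule fmeasurableI)
        show "(\<Union>j. T j) \<in> sets lebesgue" using meas by (simp add: sets_completionI_sets)
        show "emeasure lebesgue (\<Union>j. T j) < \<infinity>" using lt em by (simp add: less_top order.strict_trans)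
      qed
      then have "ennreal (measure lebesgue (\<Union>j. T j)) < ennreal e"
        using lt by (simp only: em [symmetric] emeasure_eq_measure2)
      then show "measure lebesgue (\<Union>j. T j) < e" by (simp add: ennreal_less_iff)
    qed
  qed
qed

section \<open>Crossings of a ray with the boundary\<close>

lemma interval_avoiding_frontier:
  fixes A :: "real set"
  assumes "connected S" "S \<inter> frontier A = {}" "x \<in> S" "y \<in> S"
  shows "x \<in> A \<longleftrightarrow> y \<in> A"
  using connected_Int_frontier [OF assms(1), of A] assms(2-4) by blast

text \<open>Moving right from \<open>a\<close>, the indicator of \<open>A\<close> is constant off
  \<open>P\<close>, drops by \<open>\<sigma> t\<close> when passing \<open>t\<close> in
  \<open>P\<close>, and is 0 beyond \<open>M\<close>; the drops telescope. The induction passes the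
  first crossing and restarts just behind it.\<close>

lemma crossing_sum:
  fixes A P :: "real set" and \<sigma> :: "real \<Rightarrow> real"
  assumes "finite P" "P \<subseteq> {a<..}" "\<And>t. t \<ge> a \<Longrightarrow> t \<notin> P \<Longrightarrow> t \<notin> frontier A" "A \<subseteq> {..M}"
    and "\<And>t. t \<in> P \<Longrightarrow> \<exists>e>0. (\<sigma> t = 1 \<and> {t-e<..<t} \<subseteq> A \<and> {t<..<t+e} \<inter> A = {}) \<or>
      (\<sigma> t = -1 \<and> {t-e<..<t} \<inter> A = {} \<and> {t<..<t+e} \<subseteq> A)"
  shows "(\<Sum>t\<in>P. \<sigma> t) = indicator A a"
  using assms
proof (induction "card P" arbitrary: P a)
  case 0
  then have P: "P = {}" by simp
  \<comment> \<open>Without crossings membership is constant on the half-line, which contains a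
    point beyond the bound \<open>M\<close>.\<close>
  have "a \<in> A \<longleftrightarrow> max a (M + 1) \<in> A"
    by (rule interval_avoiding_frontier [of "{a..}"]) (use 0 P in auto)
  then have "a \<notin> A" using 0 by auto
  then show ?case by (simp add: P)
next
  case (Suc k)
  have ne: "P \<noteq> {}" using Suc.hyps(2) by auto
  define t where "t = Min P"
  have t: "t \<in> P" "\<And>u. u \<in> P \<Longrightarrow> t \<le> u" using ne Suc.prems(1) by (auto simp: t_def)
  then have at: "a < t" using Suc.prems(2) by auto
  obtain e where e: "e > 0" "(\<sigma> t = 1 \<and> {t-e<..<t} \<subseteq> A \<and> {t<..<t+e} \<inter> A = {}) \<or>
      (\<sigma> t = -1 \<and> {t-e<..<t} \<inter> A = {} \<and> {t<..<t+e} \<subseteq> A)"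
    using Suc.prems(5) [OF t(1)] by blast
  \<comment> \<open>\<open>u\<close> is the next crossing or the end of the window in which the
    behaviour after \<open>t\<close> is known, whichever comes first; a point \<open>b\<close>
    between \<open>t\<close> and \<open>u\<close> serves both purposes.\<close>
  define u where "u = Min (insert (t + e) (P - {t}))"
  have u: "u \<le> t + e" "\<And>w. w \<in> P - {t} \<Longrightarrow> u \<le> w" "u \<in> insert (t + e) (P - {t})"
    using Suc.prems(1) Min_in [of "insert (t + e) (P - {t})"] by (auto simp: u_def)
  have tu: "t < u" using u(3) e(1) t(2) by force
  define b where "b = (t + u) / 2"
  have b: "t < b" "b < u" using tu by (auto simp: b_def)
  have IH: "(\<Sum>t\<in>P - {t}. \<sigma> t) = indicator A b"
  proof (rule Suc.hyps(1))
    show "k = card (P - {t})" using Suc.hyps(2) t(1) Suc.prems(1) by simp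
    show "P - {t} \<subseteq> {b<..}" using u(2) b(2) by fastforce
    show "w \<notin> frontier A" if "w \<ge> b" "w \<notin> P - {t}" for w
      using Suc.prems(3) [of w] that b at by auto
  qed (use Suc.prems in auto)
  \<comment> \<open>\<open>c\<close> lies in the window just before \<open>t\<close> without falling
    below \<open>a\<close>, so it has the same membership as \<open>a\<close>.\<close>
  define c where "c = (max a (t - e) + t) / 2"
  have c: "a \<le> c" "t - e < c" "c < t" using at e(1) by (auto simp: c_def max_def)
  have ac: "a \<in> A \<longleftrightarrow> c \<in> A"
  proof (rule interval_avoiding_frontier [of "{a..<t}"])
    show "{a..<t} \<inter> frontier A = {}" using Suc.prems(3) t(2) by force
  qed (use c at in auto)
  have "(\<Sum>t\<in>P. \<sigma> t) = \<sigma> t + indicator A b"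
    using sum.remove [OF Suc.prems(1) t(1), of \<sigma>] IH by simp
  also have "\<dots> = indicator A a"
  proof -
    have "b \<in> {t<..<t+e}" "c \<in> {t-e<..<t}" using b c u(1) by auto
    then show ?thesis using e(2) ac by (auto simp: indicator_def)
  qed
  finally show ?case .
qed

section \<open>Patch determinants and ray directions at a regular boundary point\<close>

lemma partial_deriv_eq:
  assumes "(s has_derivative s') (at t)"
  shows "((\<lambda>h. s (t + h *\<^sub>R axis j 1)) has_vector_derivative s' (axis j 1)) (at 0)"
    and "partial_deriv s j t = s' (axis j 1)"
proof -
  have "((\<lambda>h. t + h *\<^sub>R axis j (1::real)) has_derivative (\<lambda>h. h *\<^sub>R axis j 1)) (at 0)"
    by (auto intro!: derivative_eq_intros)
  from has_derivative_compose [OF this, of s s'] assms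
  have "((\<lambda>h. s (t + h *\<^sub>R axis j 1)) has_derivative (\<lambda>h. s' (h *\<^sub>R axis j 1))) (at 0)" by simp
  then show 1: "((\<lambda>h. s (t + h *\<^sub>R axis j 1)) has_vector_derivative s' (axis j 1)) (at 0)"
    using has_derivative_linear [OF assms] by (simp add: has_vector_derivative_def linear_scale)
  then show "partial_deriv s j t = s' (axis j 1)"
    unfolding partial_deriv_def by (rule vector_derivative_at)
qed

text \<open>All columns lie in the hyperplane orthogonal to \<open>\<nu>\<close>, so the transposed
  matrix has \<open>\<nu>\<close> in its kernel.\<close>

lemma tangent_det_orthogonal:
  assumes "\<nu> \<noteq> 0" "\<nu> \<bullet> w = 0" "\<And>j. \<nu> \<bullet> partial_deriv s j t = 0"
  shows "tangent_det s t w = 0"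
proof -
  let ?M = "\<chi> row col. (case col of None \<Rightarrow> w | Some j \<Rightarrow> partial_deriv s j t) $ row"
  have "transpose ?M *v \<nu> = 0"
    using assms(2,3)
    by (auto simp: vec_eq_iff matrix_vector_mult_def transpose_def inner_vec_def mult.commute
        split: option.split)
  then have "\<not> invertible (transpose ?M)"
    using assms(1) matrix_left_invertible_ker [of "transpose ?M"] by (auto simp: invertible_def)
  then show ?thesis
    unfolding tangent_det_def by (simp add: invertible_det_nz det_transpose)
qed

text \<open>Only the component of \<open>a\<close> along \<open>\<nu>\<close> contributes, because
  the rest lies in the hyperplane of the tangent vectors. This separates the orientation of the
  patch from the direction of \<open>a\<close>.\<close>

lemma tangent_det_normal:
  assumes "norm \<nu> = 1" "\<And>j. \<nu> \<bullet> partial_deriv s j t = 0"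
  shows "tangent_det s t a = (normal_vec s t \<bullet> \<nu>) * (\<nu> \<bullet> a)"
proof -
  have \<nu>: "\<nu> \<bullet> \<nu> = 1" "\<nu> \<noteq> 0" using assms(1) by (auto simp: norm_eq_1)
  have "a = (\<nu> \<bullet> a) *\<^sub>R \<nu> + (a - (\<nu> \<bullet> a) *\<^sub>R \<nu>)" by simp
  then have "tangent_det s t a =
      (\<nu> \<bullet> a) * tangent_det s t \<nu> + tangent_det s t (a - (\<nu> \<bullet> a) *\<^sub>R \<nu>)"
    using linear_add [OF linear_tangent_det] linear_scale [OF linear_tangent_det]
    by (metis real_scaleR_def)
  also have "tangent_det s t (a - (\<nu> \<bullet> a) *\<^sub>R \<nu>) = 0"
    by (rule tangent_det_orthogonal [OF \<nu>(2) _ assms(2)]) (simp add: inner_diff_right \<nu>)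
  finally show ?thesis by (simp add: inner_normal_vec [symmetric] inner_commute)
qed

context
  fixes R U :: "(real^('k::finite) option) set" and g :: "real^'k option \<Rightarrow> real"
    and p \<nu> :: "real^'k option" and c :: real
  assumes R: "closed R" and U: "open U" "p \<in> U" and g: "continuous_on U g" "g p = 0"
    and RU: "R \<inter> U = {x \<in> U. g x \<le> 0}" and c: "c > 0"
    and grad: "(g has_derivative (\<lambda>v. c * (\<nu> \<bullet> v))) (at p)"
begin

text \<open>A point of \<open>U\<close> with \<open>g < 0\<close> has a whole neighbourhood in
  \<open>R\<close>, hence is interior; positive values are excluded because \<open>R\<close> is
  closed and contains its frontier.\<close>

lemma frontier_level_zero:
  assumes "x \<in> U" "x \<in> frontier R"
  shows "g x = 0"
proof (rule ccontr)
  assume "g x \<noteq> 0"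
  moreover have "x \<in> R" using R assms(2) by (auto simp: frontier_def)
  then have "g x \<le> 0" using RU assms(1) by blast
  ultimately have neg: "g x < 0" by simp
  have op: "open (U \<inter> g -` {..<0})"
    by (rule continuous_open_preimage [OF g(1) U(1)]) simp
  have "U \<inter> g -` {..<0} \<subseteq> R"
  proof
    fix y assume "y \<in> U \<inter> g -` {..<0}"
    then have "y \<in> {x \<in> U. g x \<le> 0}" by auto
    then show "y \<in> R" unfolding RU [symmetric] by blast
  qed
  then have "x \<in> interior R" using op neg assms(1) by (intro interiorI) auto
  then show False using assms(2) by (simp add: frontier_def)
qed

text \<open>Near an interior parameter the patch stays in the frontier, so \<open>g\<close> vanishes
  along every coordinate curve and the chain rule gives derivative 0.\<close>

lemma tangent_orthogonal_gradient:
  assumes t: "t \<in> interior D" and sub: "s ` D \<subseteq> frontier R" and p: "s t = p"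
    and s: "(s has_derivative s') (at t)"
  shows "\<nu> \<bullet> partial_deriv s j t = 0"
proof -
  note d = partial_deriv_eq [OF s, where j = j]
  let ?\<gamma> = "\<lambda>h. s (t + h *\<^sub>R axis j 1)"
  have \<gamma>0: "?\<gamma> 0 = p" using p by simp
  have "(g has_derivative (\<lambda>v. c * (\<nu> \<bullet> v))) (at (?\<gamma> 0))" using grad \<gamma>0 by simp
  then have "((\<lambda>h. g (?\<gamma> h)) has_derivative (\<lambda>h. c * (\<nu> \<bullet> (h *\<^sub>R s' (axis j 1))))) (at 0)"
    using has_derivative_compose d(1) unfolding has_vector_derivative_def by blast
  then have 1: "((\<lambda>h. g (?\<gamma> h)) has_real_derivative c * (\<nu> \<bullet> s' (axis j 1))) (at 0)"
    by (simp add: has_field_derivative_def mult.left_commute mult.commute [of _ "c * _"])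
  have cont: "isCont ?\<gamma> 0" using d(1) by (rule has_vector_derivative_continuous)
  have "\<forall>\<^sub>F h in at 0. ?\<gamma> h \<in> U"
    using cont U \<gamma>0 by (metis isCont_def topological_tendstoD)
  moreover have "\<forall>\<^sub>F h in at 0. t + h *\<^sub>R axis j (1::real) \<in> interior D"
  proof (rule topological_tendstoD)
    show "((\<lambda>h. t + h *\<^sub>R axis j (1::real)) \<longlongrightarrow> t) (at 0)" by (auto intro!: tendsto_eq_intros)
  qed (use t in auto)
  ultimately have ev: "\<forall>\<^sub>F h in at 0. g (?\<gamma> h) = 0"
  proof eventually_elim
    case (elim h)
    then have "?\<gamma> h \<in> frontier R" using sub interior_subset by blast
    then show ?case using elim frontier_level_zero by blast
  qed
  have "((\<lambda>h. 0) has_real_derivative c * (\<nu> \<bullet> s' (axis j 1))) (at 0)"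
    unfolding has_field_derivative_def
    by (rule has_derivative_transform_eventually [OF 1 [unfolded has_field_derivative_def] ev])
      (simp_all add: p g(2))
  then have "c * (\<nu> \<bullet> s' (axis j 1)) = 0" using DERIV_const DERIV_unique by blast
  then show ?thesis using c d(2) by simp
qed

text \<open>Along the ray \<open>g\<close> has the nonzero derivative
  \<open>c * (\<nu> \<bullet> v)\<close> at its zero \<open>t\<close>, so it changes sign there:
  positive derivative means leaving \<open>R\<close>, negative means entering. The last conjunct
  isolates the crossing and is used for finiteness.\<close>

lemma ray_crossing:
  assumes p: "p = x0 + t *\<^sub>R v" and nz: "\<nu> \<bullet> v \<noteq> 0"
  shows "\<exists>e>0. ((sgn (\<nu> \<bullet> v) = 1 \<and> {t-e<..<t} \<subseteq> {l. x0 + l *\<^sub>R v \<in> R} \<and>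
        {t<..<t+e} \<inter> {l. x0 + l *\<^sub>R v \<in> R} = {}) \<or>
      (sgn (\<nu> \<bullet> v) = -1 \<and> {t-e<..<t} \<inter> {l. x0 + l *\<^sub>R v \<in> R} = {} \<and>
        {t<..<t+e} \<subseteq> {l. x0 + l *\<^sub>R v \<in> R})) \<and>
      (\<forall>l. l \<noteq> t \<longrightarrow> \<bar>l - t\<bar> < e \<longrightarrow> x0 + l *\<^sub>R v \<notin> frontier R)"
proof -
  let ?\<gamma> = "\<lambda>l. x0 + l *\<^sub>R v"
  have d: "(?\<gamma> has_derivative (\<lambda>h. h *\<^sub>R v)) (at t)" by (auto intro!: derivative_eq_intros)
  have "(g has_derivative (\<lambda>v. c * (\<nu> \<bullet> v))) (at (?\<gamma> t))" using grad p by simp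
  from has_derivative_compose [OF d this]
  have D: "((\<lambda>l. g (?\<gamma> l)) has_real_derivative c * (\<nu> \<bullet> v)) (at t)"
    by (simp add: has_field_derivative_def mult.left_commute mult.commute [of _ "c * _"])
  have "open (?\<gamma> -` U)" by (rule open_vimage [OF U(1)]) (intro continuous_intros)
  moreover have "t \<in> ?\<gamma> -` U" using U(2) p by simp
  ultimately obtain e0 where e0: "e0 > 0" "\<And>l. \<bar>l - t\<bar> < e0 \<Longrightarrow> ?\<gamma> l \<in> U"
    unfolding open_dist by (auto simp: dist_real_def)
  have gt: "g (?\<gamma> t) = 0" using g(2) p by simp
  have nf: "?\<gamma> l \<notin> frontier R" if "\<bar>l - t\<bar> < e0" "g (?\<gamma> l) \<noteq> 0" for l
    using frontier_level_zero e0(2) that by blast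
  have inR: "?\<gamma> l \<in> R \<longleftrightarrow> g (?\<gamma> l) \<le> 0" if "\<bar>l - t\<bar> < e0" for l
    using RU e0(2) [OF that] by blast
  show ?thesis
  proof (cases "\<nu> \<bullet> v > 0")
    case True
    then have pos: "c * (\<nu> \<bullet> v) > 0" using c by simp
    obtain d1 where d1: "d1 > 0" "\<And>h. 0 < h \<Longrightarrow> h < d1 \<Longrightarrow> 0 < g (?\<gamma> (t + h))"
      using has_real_derivative_pos_inc_right [OF D pos] gt by auto
    obtain d2 where d2: "d2 > 0" "\<And>h. 0 < h \<Longrightarrow> h < d2 \<Longrightarrow> g (?\<gamma> (t - h)) < 0"
      using has_real_derivative_pos_inc_left [OF D pos] gt by auto
    define e where "e = min e0 (min d1 d2)"
    have e: "e \<le> e0" "e \<le> d1" "e \<le> d2" by (auto simp: e_def)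
    have R1: "0 < g (?\<gamma> l)" if "t < l" "l < t + e" for l
      using d1(2) [of "l - t"] that e by simp
    have L1: "g (?\<gamma> l) < 0" if "t - e < l" "l < t" for l
      using d2(2) [of "t - l"] that e by simp
    have "{t-e<..<t} \<subseteq> {l. ?\<gamma> l \<in> R}"
    proof
      fix l assume l: "l \<in> {t-e<..<t}"
      then have "\<bar>l - t\<bar> < e0" using e by (auto simp: abs_less_iff)
      then show "l \<in> {l. ?\<gamma> l \<in> R}" using inR [of l] L1 [of l] l by simp
    qed
    moreover have "{t<..<t+e} \<inter> {l. ?\<gamma> l \<in> R} = {}"
    proof -
      have False if l: "l \<in> {t<..<t+e}" "?\<gamma> l \<in> R" for l
      proof -
        have "\<bar>l - t\<bar> < e0" using l e by (auto simp: abs_less_iff)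
        then show False using inR [of l] R1 [of l] l by simp
      qed
      then show ?thesis by blast
    qed
    moreover have "?\<gamma> l \<notin> frontier R" if "l \<noteq> t" "\<bar>l - t\<bar> < e" for l
    proof (rule nf)
      show "\<bar>l - t\<bar> < e0" using that e by simp
      show "g (?\<gamma> l) \<noteq> 0" using that R1 [of l] L1 [of l] by (cases "l < t") auto
    qed
    moreover have "e > 0" using e0 d1 d2 by (simp add: e_def)
    ultimately show ?thesis using True by (intro exI [of _ e]) simp
  next
    case False
    then have neg: "c * (\<nu> \<bullet> v) < 0" "\<nu> \<bullet> v < 0" using c nz by (auto simp: mult_less_0_iff)
    obtain d1 where d1: "d1 > 0" "\<And>h. 0 < h \<Longrightarrow> h < d1 \<Longrightarrow> g (?\<gamma> (t + h)) < 0"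
      using has_real_derivative_neg_dec_right [OF D neg(1)] gt by auto
    obtain d2 where d2: "d2 > 0" "\<And>h. 0 < h \<Longrightarrow> h < d2 \<Longrightarrow> 0 < g (?\<gamma> (t - h))"
      using has_real_derivative_neg_dec_left [OF D neg(1)] gt by auto
    define e where "e = min e0 (min d1 d2)"
    have e: "e \<le> e0" "e \<le> d1" "e \<le> d2" by (auto simp: e_def)
    have R1: "g (?\<gamma> l) < 0" if "t < l" "l < t + e" for l
      using d1(2) [of "l - t"] that e by simp
    have L1: "0 < g (?\<gamma> l)" if "t - e < l" "l < t" for l
      using d2(2) [of "t - l"] that e by simp
    have "{t<..<t+e} \<subseteq> {l. ?\<gamma> l \<in> R}"
    proof
      fix l assume l: "l \<in> {t<..<t+e}"
      then have "\<bar>l - t\<bar> < e0" using e by (auto simp: abs_less_iff)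
      then show "l \<in> {l. ?\<gamma> l \<in> R}" using inR [of l] R1 [of l] l by simp
    qed
    moreover have "{t-e<..<t} \<inter> {l. ?\<gamma> l \<in> R} = {}"
    proof -
      have False if l: "l \<in> {t-e<..<t}" "?\<gamma> l \<in> R" for l
      proof -
        have "\<bar>l - t\<bar> < e0" using l e by (auto simp: abs_less_iff)
        then show False using inR [of l] L1 [of l] l by simp
      qed
      then show ?thesis by blast
    qed
    moreover have "?\<gamma> l \<notin> frontier R" if "l \<noteq> t" "\<bar>l - t\<bar> < e" for l
    proof (rule nf)
      show "\<bar>l - t\<bar> < e0" using that e by simp
      show "g (?\<gamma> l) \<noteq> 0" using that R1 [of l] L1 [of l] by (cases "l < t") auto
    qed
    moreover have "e > 0" using e0 d1 d2 by (simp add: e_def)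
    ultimately show ?thesis using neg by (intro exI [of _ e]) simp
  qed
qed

end

section \<open>The cone over a patch\<close>

definition cone_map ::
    "real^'k option \<Rightarrow> (real^'k \<Rightarrow> real^'k option) \<Rightarrow> real \<times> (real^'k) \<Rightarrow> real^'k option" where
  "cone_map x0 s y = scaling_map x0 s (fst y) (snd y)"

definition cone_deriv ::
    "real^'k option \<Rightarrow> (real^'k \<Rightarrow> real^'k option) \<Rightarrow> real \<times> (real^'k) \<Rightarrow>
      real \<times> (real^'k) \<Rightarrow> real^'k option" where
  "cone_deriv x0 s y v = fst v *\<^sub>R (s (snd y) - x0) +
     fst y *\<^sub>R frechet_derivative s (at (snd y)) (snd v)"

text \<open>The open part of \<open>{0..1} \<times> D\<close> to which the signed area formula
  applies. The parameters left out either form a null set or have Jacobian 0, so they do not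
  contribute to the integral.\<close>

definition cone_dom ::
    "real^'k option \<Rightarrow> (real^'k) set \<Rightarrow> (real^'k \<Rightarrow> real^'k option) \<Rightarrow> (real \<times> (real^'k)) set" where
  "cone_dom x0 D s = {y. 0 < fst y \<and> fst y < 1 \<and> snd y \<in> interior D \<and>
     scaling_jacobian x0 s (fst y) (snd y) \<noteq> 0}"

text \<open>The radial column is \<open>s t - x0\<close> without a factor; each of the other
  \<open>CARD('k)\<close> columns is a partial derivative scaled by \<open>\<rho>\<close>, which
  produces the power of \<open>\<rho>\<close>.\<close>

lemma jac_cone_deriv:
  fixes s :: "real^'k::finite \<Rightarrow> real^'k option"
  assumes "s differentiable (at (snd y))"
  shows "jac (cone_deriv x0 s y) = scaling_jacobian x0 s (fst y) (snd y)"
proof -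
  let ?s' = "frechet_derivative s (at (snd y))"
  let ?col = "\<lambda>col. case col of None \<Rightarrow> s (snd y) - x0 | Some j \<Rightarrow> partial_deriv s j (snd y)"
  let ?c = "\<lambda>col :: 'k option. case col of None \<Rightarrow> 1 | Some j \<Rightarrow> fst y"
  have s': "(s has_derivative ?s') (at (snd y))"
    using assms by (simp add: frechet_derivative_works)
  have "?s' 0 = 0" using has_derivative_linear [OF s'] by (rule linear_0)
  then have col: "cone_deriv x0 s y (param_dir col) = ?c col *\<^sub>R ?col col" for col
    by (simp add: cone_deriv_def param_dir_def partial_deriv_eq(2) [OF s'] split: option.split)
  have "jac (cone_deriv x0 s y) = det (\<chi> col. ?c col *s ?col col)"
    unfolding jac_def
    by (subst det_transpose [symmetric], rule arg_cong [where f = det])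
       (simp add: transpose_def vec_eq_iff col)
  also have "\<dots> = prod ?c UNIV * det (\<chi> col. ?col col)"
    by (rule det_rows_mul)
  also have "prod ?c UNIV = fst y ^ CARD('k)"
    by (simp add: UNIV_option_conv prod.reindex)
  also have "det (\<chi> col. ?col col) = tangent_det s (snd y) (s (snd y) - x0)"
    unfolding tangent_det_def
    by (subst det_transpose [symmetric], rule arg_cong [where f = det])
       (simp add: transpose_def vec_eq_iff)
  finally show ?thesis by (simp add: scaling_jacobian_def)
qed

section \<open>Null sets and iterated integrals on product domains\<close>

text \<open>Closedness makes the factor Borel, so the product measure can be evaluated as infinity
  times 0, which is 0.\<close>

lemma negligible_UNIV_Times:
  fixes S :: "'b::euclidean_space set"
  assumes "closed S" "negligible S"
  shows "negligible ((UNIV :: 'a::euclidean_space set) \<times> S)"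
proof -
  have "emeasure lborel S = 0"
    using assms by (simp add: negligible_iff_null_sets null_sets_def)
  then have "emeasure (lborel \<Otimes>\<^sub>M lborel) ((UNIV :: 'a set) \<times> S) = 0"
    using assms(1) by (subst lborel.emeasure_pair_measure_Times) auto
  moreover have "closed ((UNIV :: 'a set) \<times> S)" using assms(1) by (intro closed_Times) auto
  ultimately show ?thesis
    by (simp add: lborel_prod negligible_iff_null_sets null_sets_def)
qed

lemma negligible_fst_eq: "negligible {y :: real \<times> 'b::euclidean_space. fst y = c}"
proof -
  have "negligible {y :: real \<times> 'b. (1, 0) \<bullet> y = c}" by (rule negligible_hyperplane) (simp add: zero_prod_def)
  then show ?thesis by (simp add: inner_prod_def)
qed

lemma integral_Times_compact:
  fixes g :: "real \<times> 'b::euclidean_space \<Rightarrow> real"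
  assumes I: "compact I" and D: "compact D" and g: "continuous_on (I \<times> D) g"
  shows "integral (I \<times> D) g = integral I (\<lambda>\<rho>. integral D (\<lambda>t. g (\<rho>, t)))"
proof -
  let ?G = "\<lambda>y. indicator (I \<times> D) y *\<^sub>R g y"
  have int: "integrable lborel ?G"
    using compact_Times [OF I D] g by (rule borel_integrable_compact)
  then have int': "integrable (lborel \<Otimes>\<^sub>M lborel) ?G" by (simp add: lborel_prod)
  have inner: "(\<integral>t. ?G (\<rho>, t) \<partial>lborel) = indicator I \<rho> *\<^sub>R integral D (\<lambda>t. g (\<rho>, t))" for \<rho>
  proof (cases "\<rho> \<in> I")
    case True
    have "continuous_on D (\<lambda>t. g (\<rho>, t))"
      by (rule continuous_on_compose2 [OF g]) (auto intro!: continuous_intros True)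
    then have "set_integrable lborel D (\<lambda>t. g (\<rho>, t))"
      unfolding set_integrable_def by (rule borel_integrable_compact [OF D])
    from set_borel_integral_eq_integral(2) [OF this] show ?thesis
      using True by (simp add: set_lebesgue_integral_def indicator_times)
  qed (simp add: indicator_times)
  have "set_integrable lborel I (\<lambda>\<rho>. integral D (\<lambda>t. g (\<rho>, t)))"
    using lborel_pair.integrable_fst' [OF int'] unfolding inner set_integrable_def .
  from set_borel_integral_eq_integral(2) [OF this]
  have "integral I (\<lambda>\<rho>. integral D (\<lambda>t. g (\<rho>, t))) = (\<integral>\<rho>. (\<integral>t. ?G (\<rho>, t) \<partial>lborel) \<partial>lborel)"
    by (simp only: inner set_lebesgue_integral_def)
  also have "\<dots> = integral\<^sup>L (lborel \<Otimes>\<^sub>M lborel) ?G" by (rule lborel_pair.integral_fst' [OF int'])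
  also have "\<dots> = (LINT y : I \<times> D | lborel. g y)"
    by (simp only: lborel_prod set_lebesgue_integral_def)
  also have "\<dots> = integral (I \<times> D) g"
    by (rule set_borel_integral_eq_integral) (use int in \<open>simp add: set_integrable_def\<close>)
  finally show ?thesis by simp
qed

context
  fixes x0 :: "real^('k::finite) option" and D :: "(real^'k) set" and s :: "real^'k \<Rightarrow> real^'k option"
    and V :: "(real^'k) set"
  assumes D: "compact D" "negligible (frontier D)" and V: "open V" "D \<subseteq> V" and s: "Ck_on 1 s V"
begin

lemma patch_has_derivative:
  assumes "t \<in> V"
  shows "(s has_derivative frechet_derivative s (at t)) (at t)"
proof -
  have "s differentiable_on V" using s by simp
  then have "s differentiable (at t)" using V(1) assms by (simp add: differentiable_on_eq_differentiable_at)
  then show ?thesis by (simp add: frechet_derivative_works)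
qed

lemma jac_cone: "snd y \<in> V \<Longrightarrow> jac (cone_deriv x0 s y) = scaling_jacobian x0 s (fst y) (snd y)"
  by (rule jac_cone_deriv) (use patch_has_derivative in \<open>auto simp: differentiable_def\<close>)

lemma cone_map_has_derivative:
  assumes "snd y \<in> V"
  shows "(cone_map x0 s has_derivative cone_deriv x0 s y) (at y)"
proof -
  have "((\<lambda>y. s (snd y)) has_derivative (\<lambda>v. frechet_derivative s (at (snd y)) (snd v))) (at y)"
    using has_derivative_compose [OF has_derivative_snd [OF has_derivative_ident] patch_has_derivative [OF assms]] .
  then have "((\<lambda>y. x0 + fst y *\<^sub>R (s (snd y) - x0)) has_derivative cone_deriv x0 s y) (at y)"
    by (auto intro!: derivative_eq_intros simp: cone_deriv_def fun_eq_iff algebra_simps)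
  then show ?thesis by (simp add: cone_map_def [abs_def] scaling_map_def)
qed

lemma continuous_on_patch: "continuous_on V s"
  using s by (auto intro: differentiable_imp_continuous_on)

lemma continuous_on_cone_map: "continuous_on (UNIV \<times> V) (cone_map x0 s)"
  unfolding cone_map_def [abs_def] scaling_map_def
  by (intro continuous_intros continuous_on_compose2 [OF continuous_on_patch]) auto

lemma continuous_on_cone_deriv: "continuous_on (UNIV \<times> V) (\<lambda>y. cone_deriv x0 s y v)"
proof -
  have snd: "continuous_on (UNIV \<times> V) snd" "snd ` (UNIV \<times> V) \<subseteq> V"
    by (auto intro: continuous_on_snd continuous_on_id)
  have "continuous_on V (\<lambda>t. frechet_derivative s (at t) (snd v))" using s by simp
  then have "continuous_on (UNIV \<times> V) (\<lambda>y. frechet_derivative s (at (snd y)) (snd v))"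
    using snd by (rule continuous_on_compose2)
  moreover have "continuous_on (UNIV \<times> V) (\<lambda>y. s (snd y))"
    using continuous_on_patch snd by (rule continuous_on_compose2)
  ultimately show ?thesis
    unfolding cone_deriv_def by (intro continuous_intros)
qed

lemma continuous_on_cone_jacobian:
  "continuous_on (UNIV \<times> V) (\<lambda>y. scaling_jacobian x0 s (fst y) (snd y))"
  using continuous_on_jac [where F' = "cone_deriv x0 s", OF continuous_on_cone_deriv]
  by (rule continuous_on_cong [THEN iffD1, rotated -1]) (auto simp: jac_cone)

lemma cone_dom_subset: "cone_dom x0 D s \<subseteq> {0..1} \<times> D" "cone_dom x0 D s \<subseteq> UNIV \<times> V"
  using interior_subset [of D] V(2) by (auto simp: cone_dom_def)

lemma open_cone_dom: "open (cone_dom x0 D s)"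
proof -
  let ?W = "{0<..<1::real} \<times> interior D"
  have W: "?W \<subseteq> UNIV \<times> V" using interior_subset V(2) by blast
  have "open (?W \<inter> (\<lambda>y. scaling_jacobian x0 s (fst y) (snd y)) -` (- {0}))"
    by (rule continuous_open_preimage [OF continuous_on_subset [OF continuous_on_cone_jacobian W]])
      (auto intro: open_Times)
  moreover have "?W \<inter> (\<lambda>y. scaling_jacobian x0 s (fst y) (snd y)) -` (- {0}) = cone_dom x0 D s"
    by (auto simp: cone_dom_def)
  ultimately show ?thesis by simp
qed

lemma negligible_cone_image:
  assumes "negligible S" "S \<subseteq> UNIV \<times> V"
  shows "negligible (cone_map x0 s ` S)"
proof (rule negligible_differentiable_image_negligible [OF _ assms(1)])
  show "cone_map x0 s differentiable_on S"
    unfolding differentiable_on_def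
  proof
    fix y assume "y \<in> S"
    then have "snd y \<in> V" using assms(2) by auto
    then show "cone_map x0 s differentiable (at y within S)"
      using cone_map_has_derivative has_derivative_at_withinI by (blast intro: differentiableI)
  qed
qed simp

lemma negligible_cone_frontier: "negligible (cone_map x0 s ` ({0..1} \<times> frontier D))"
proof (rule negligible_cone_image)
  show "negligible ({0..1} \<times> frontier D :: (real \<times> (real^'k)) set)"
    by (rule negligible_subset [OF negligible_UNIV_Times [OF frontier_closed D(2)]]) auto
  show "{0..1} \<times> frontier D \<subseteq> UNIV \<times> V"
    using frontier_subset_closed [OF compact_imp_closed [OF D(1)]] V(2) by auto
qed

lemma negligible_cone_critical:
  "negligible (cone_map x0 s ` {y \<in> {0..1} \<times> D. scaling_jacobian x0 s (fst y) (snd y) = 0})"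
  (is "negligible (_ ` ?S)")
proof (rule Sard_jac)
  fix y assume "y \<in> ?S"
  then have y: "snd y \<in> V" "scaling_jacobian x0 s (fst y) (snd y) = 0" using V(2) by auto
  show "(cone_map x0 s has_derivative cone_deriv x0 s y) (at y within ?S)"
    using cone_map_has_derivative [OF y(1)] by (rule has_derivative_at_withinI)
  show "jac (cone_deriv x0 s y) = 0" using y by (simp add: jac_cone)
qed

text \<open>The patch is the slice \<open>\<rho> = 1\<close> of its cone: the image of a null set
  under a differentiable map between spaces of equal dimension.\<close>

lemma negligible_patch: "negligible (s ` D)"
proof -
  have "negligible (cone_map x0 s ` ({1} \<times> D))"
    by (rule negligible_cone_image, rule negligible_subset [OF negligible_fst_eq [of 1]])
      (use V(2) in auto)
  moreover have "cone_map x0 s ` ({1} \<times> D) = s ` D"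
    by (force simp: cone_map_def scaling_map_def)
  ultimately show ?thesis by simp
qed

text \<open>The weight in \<open>k\<close> is the signed number of parameters over \<open>x\<close>.
  The area formula treats \<open>cone_dom\<close>; the integral is then extended to the full product
  and iterated.\<close>

lemma cone_integral:
  fixes f :: "real^'k option \<Rightarrow> real"
  assumes f: "continuous_on (cone_map x0 s ` ({0..1} \<times> D)) f"
    and N: "negligible N" "\<And>x. x \<notin> N \<Longrightarrow> finite {y \<in> cone_dom x0 D s. cone_map x0 s y = x}"
  defines "k \<equiv> \<lambda>x. f x * (\<Sum>y | y \<in> cone_dom x0 D s \<and> cone_map x0 s y = x.
      sgn (scaling_jacobian x0 s (fst y) (snd y)))"
  shows "k absolutely_integrable_on UNIV"
    and "integral UNIV k = integral {0..1} (\<lambda>\<rho>. integral D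
      (\<lambda>t. f (scaling_map x0 s \<rho> t) * scaling_jacobian x0 s \<rho> t))"
proof -
  let ?K = "{0..1::real} \<times> D" and ?G = "cone_dom x0 D s"
  let ?J = "\<lambda>y. scaling_jacobian x0 s (fst y) (snd y)"
  let ?g = "\<lambda>y. f (cone_map x0 s y) * ?J y"
  have KV: "?K \<subseteq> UNIV \<times> V" using V(2) by auto
  have contg: "continuous_on ?K ?g"
    by (intro continuous_intros continuous_on_compose2 [OF f]
        continuous_on_subset [OF continuous_on_cone_map KV]
        continuous_on_subset [OF continuous_on_cone_jacobian KV]) auto
  have compK: "compact ?K" using D(1) by (intro compact_Times) auto
  have int: "integrable lborel (\<lambda>y. indicator ?K y *\<^sub>R ?g y)"
    by (rule borel_integrable_compact [OF compK contg])
  then have gK: "?g absolutely_integrable_on ?K"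
    using integrable_completion [OF borel_measurable_integrable [OF int]]
    by (simp only: set_integrable_def)
  have gG: "?g absolutely_integrable_on ?G"
    by (rule set_integrable_subset [OF gK]) (use open_cone_dom cone_dom_subset in auto)
  have jacG: "jac (cone_deriv x0 s y) = ?J y" if "y \<in> ?G" for y
    using that cone_dom_subset(2) by (intro jac_cone) auto
  have fib: "(\<Sum>y | y \<in> ?G \<and> cone_map x0 s y = x. sgn (?J y)) =
      (\<Sum>y | y \<in> ?G \<and> cone_map x0 s y = x. sgn (jac (cone_deriv x0 s y)))" for x
    by (intro sum.cong) (auto simp: jacG)
  have deriv: "(cone_map x0 s has_derivative cone_deriv x0 s y) (at y)" if "y \<in> ?G" for y
    using that cone_dom_subset(2) by (intro cone_map_has_derivative) auto
  have nz: "jac (cone_deriv x0 s y) \<noteq> 0" if "y \<in> ?G" for y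
    using that by (simp add: jacG) (simp add: cone_dom_def)
  have contd: "continuous_on ?G (\<lambda>y. cone_deriv x0 s y v)" for v
    using continuous_on_cone_deriv cone_dom_subset(2) by (rule continuous_on_subset)
  have gG': "(\<lambda>y. f (cone_map x0 s y) * jac (cone_deriv x0 s y)) absolutely_integrable_on ?G"
    using gG by (rule set_integrable_cong [THEN iffD1, rotated -1]) (auto simp: jacG)
  note area = signed_area_formula [OF open_cone_dom deriv contd nz gG' N]
  show "k absolutely_integrable_on UNIV" unfolding k_def fib by (rule area(1))
  have "integral UNIV k = integral ?G (\<lambda>y. f (cone_map x0 s y) * jac (cone_deriv x0 s y))"
    unfolding k_def fib by (rule area(2))
  also have "\<dots> = integral ?G ?g" by (rule integral_cong) (simp add: jacG)
  also have "\<dots> = integral ?K ?g"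
  \<comment> \<open>Where the two domains differ, either the Jacobian vanishes, or
    \<open>\<rho>\<close> is 0 or 1, or \<open>t\<close> is a frontier point of
    \<open>D\<close>.\<close>
  proof (rule integral_spike_set)
    have "negligible ({y. fst y = 0} \<union> {y. fst y = 1} \<union> UNIV \<times> frontier D :: (real \<times> (real^'k)) set)"
      using D(2) by (intro negligible_Un negligible_fst_eq negligible_UNIV_Times) auto
    then show "negligible {y \<in> ?K - ?G. ?g y \<noteq> 0}"
    proof (rule negligible_subset)
      show "{y \<in> ?K - ?G. ?g y \<noteq> 0} \<subseteq> {y. fst y = 0} \<union> {y. fst y = 1} \<union> UNIV \<times> frontier D"
        using closure_subset [of D] by (auto simp: cone_dom_def frontier_def)
    qed
    show "negligible {y \<in> ?G - ?K. ?g y \<noteq> 0}"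
      using cone_dom_subset(1) by (simp add: Diff_eq_empty_iff [THEN iffD2])
  qed
  also have "\<dots> = integral {0..1} (\<lambda>\<rho>. integral D (\<lambda>t. ?g (\<rho>, t)))"
    by (rule integral_Times_compact [OF _ D(1) contg]) simp
  finally show "integral UNIV k = integral {0..1} (\<lambda>\<rho>. integral D
      (\<lambda>t. f (scaling_map x0 s \<rho> t) * scaling_jacobian x0 s \<rho> t))"
    by (simp add: cone_map_def)
qed

end

section \<open>Counting boundary points beyond a point\<close>

lemma finite_if_isolated:
  fixes P :: "real set"
  assumes "compact P" "\<And>t. t \<in> P \<Longrightarrow> \<exists>e>0. \<forall>l. l \<noteq> t \<longrightarrow> \<bar>l - t\<bar> < e \<longrightarrow> l \<notin> P"
  shows "finite P"
proof (rule ccontr)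
  assume "infinite P"
  then obtain t where t: "t \<in> P" "t islimpt P"
    using assms(1) unfolding compact_eq_Bolzano_Weierstrass by blast
  obtain e where e: "e > 0" "\<And>l. l \<noteq> t \<Longrightarrow> \<bar>l - t\<bar> < e \<Longrightarrow> l \<notin> P"
    using assms(2) [OF t(1)] by blast
  obtain l where "l \<in> P" "l \<noteq> t" "dist l t < e" using t(2) e(1) unfolding islimpt_approachable by blast
  then show False using e(2) [of l] by (simp add: dist_real_def)
qed

text \<open>A parameter with \<open>\<rho>\<close> strictly between 0 and 1 lies over
  \<open>x\<close> exactly if \<open>s t\<close> is the point at \<open>l = 1 / \<rho> > 1\<close>
  on the ray through \<open>x\<close>. This regroups the fibre by boundary points on the
  ray.\<close>

lemma sum_cone_fibre:
  fixes s :: "real^'k::finite \<Rightarrow> real^'k option"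
  assumes P: "finite P" "P \<subseteq> {1<..}"
    and fib: "\<And>l. l \<in> P \<Longrightarrow> finite {t \<in> D. s t = x0 + l *\<^sub>R (x - x0)}"
    and good: "\<And>l t. l \<in> P \<Longrightarrow> t \<in> D \<Longrightarrow> s t = x0 + l *\<^sub>R (x - x0) \<Longrightarrow>
      t \<in> interior D \<and> scaling_jacobian x0 s (1 / l) t \<noteq> 0"
    and all: "\<And>l t. l > 1 \<Longrightarrow> t \<in> D \<Longrightarrow> s t = x0 + l *\<^sub>R (x - x0) \<Longrightarrow> l \<in> P"
  shows "finite {y \<in> cone_dom x0 D s. cone_map x0 s y = x}" (is "finite ?Y")
    and "(\<Sum>y | y \<in> cone_dom x0 D s \<and> cone_map x0 s y = x.
        sgn (scaling_jacobian x0 s (fst y) (snd y))) =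
      (\<Sum>l\<in>P. \<Sum>t | t \<in> D \<and> s t = x0 + l *\<^sub>R (x - x0). sgn (tangent_det s t (s t - x0)))"
proof -
  let ?T = "\<lambda>l. {t \<in> D. s t = x0 + l *\<^sub>R (x - x0)}"
  \<comment> \<open>Inverting the first component is an involution, so the same map serves both
    directions.\<close>
  let ?j = "\<lambda>z :: real \<times> (real^'k). (1 / fst z, snd z)"
  have bij: "bij_betw ?j (Sigma P ?T) ?Y"
  proof (rule bij_betwI [where g = ?j])
    show "?j \<in> Sigma P ?T \<rightarrow> ?Y"
    proof
      fix z assume z: "z \<in> Sigma P ?T"
      have "fst z > 1" using z P(2) by auto
      then show "?j z \<in> ?Y"
        using z good by (auto simp: cone_dom_def cone_map_def scaling_map_def)
    qed
    show "?j \<in> ?Y \<rightarrow> Sigma P ?T"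
    proof
      fix y assume y: "y \<in> ?Y"
      then have \<rho>: "0 < fst y" "fst y < 1" and t: "snd y \<in> D"
        and x: "x = x0 + fst y *\<^sub>R (s (snd y) - x0)"
        using interior_subset [of D] by (auto simp: cone_dom_def cone_map_def scaling_map_def)
      have st: "s (snd y) = x0 + (1 / fst y) *\<^sub>R (x - x0)" using \<rho> by (simp add: x)
      have "1 / fst y > 1" using \<rho> by simp
      then have "1 / fst y \<in> P" using all [OF _ t st] by simp
      then show "?j y \<in> Sigma P ?T" using t st by simp
    qed
  qed auto
  have fin: "finite (Sigma P ?T)" using P(1) fib by auto
  then show "finite ?Y" using bij_betw_finite [OF bij] by simp
  have "(\<Sum>y\<in>?Y. sgn (scaling_jacobian x0 s (fst y) (snd y))) =
      (\<Sum>z\<in>Sigma P ?T. sgn (scaling_jacobian x0 s (1 / fst z) (snd z)))"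
    using sum.reindex_bij_betw [OF bij, of "\<lambda>y. sgn (scaling_jacobian x0 s (fst y) (snd y))"] by simp
  also have "\<dots> = (\<Sum>z\<in>Sigma P ?T. sgn (tangent_det s (snd z) (s (snd z) - x0)))"
  \<comment> \<open>The Jacobian differs from the tangent determinant by a positive power of
    \<open>1 / l\<close>, which leaves the sign unchanged.\<close>
  proof (rule sum.cong [OF refl])
    fix z assume "z \<in> Sigma P ?T"
    then have "fst z > 0" using P(2) by fastforce
    then show "sgn (scaling_jacobian x0 s (1 / fst z) (snd z)) = sgn (tangent_det s (snd z) (s (snd z) - x0))"
      by (simp add: scaling_jacobian_def sgn_mult)
  qed
  also have "\<dots> = (\<Sum>l\<in>P. \<Sum>t\<in>?T l. sgn (tangent_det s t (s t - x0)))"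
    using P(1) fib by (subst sum.Sigma) (auto simp: case_prod_unfold)
  finally show "(\<Sum>y\<in>?Y. sgn (scaling_jacobian x0 s (fst y) (snd y))) =
      (\<Sum>l\<in>P. \<Sum>t\<in>?T l. sgn (tangent_det s t (s t - x0)))" .
qed

lemma oriented_multiplicity:
  fixes R :: "(real^('k::finite) option) set"
  assumes R: "compact R" and rep: "represents_boundary m D s R"
  obtains N where "negligible N"
    "\<And>i x. i \<in> {1..m} \<Longrightarrow> x \<notin> N \<Longrightarrow> finite {y \<in> cone_dom x0 (D i) (s i). cone_map x0 (s i) y = x}"
    "\<And>x. x \<notin> N \<Longrightarrow> (\<Sum>i=1..m. \<Sum>y | y \<in> cone_dom x0 (D i) (s i) \<and> cone_map x0 (s i) y = x.
        sgn (scaling_jacobian x0 (s i) (fst y) (snd y))) = indicator R x"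
proof -
  have "\<forall>i\<in>{1..m}. patch (D i) (s i)" and cover: "(\<Union>i\<in>{1..m}. s i ` D i) = frontier R"
    using rep by (auto simp: represents_boundary_def)
  then have compD: "compact (D i)" and frD: "negligible (frontier (D i))"
    and "\<exists>V. open V \<and> D i \<subseteq> V \<and> Ck_on 1 (s i) V" if "i \<in> {1..m}" for i
    using that by (auto simp: patch_def)
  then obtain V where V: "\<And>i. i \<in> {1..m} \<Longrightarrow> open (V i)" "\<And>i. i \<in> {1..m} \<Longrightarrow> D i \<subseteq> V i"
    "\<And>i. i \<in> {1..m} \<Longrightarrow> Ck_on 1 (s i) (V i)" by metis
  obtain E where E: "hausdorff_null CARD('k) E" and good: "\<And>p. p \<in> frontier R - E \<Longrightarrow>
      \<exists>\<nu>. outward_unit_normal R p \<nu> \<and> (\<forall>i\<in>{1..m}. finite {t \<in> D i. s i t = p}) \<and>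
        (\<Sum>i=1..m. \<Sum>t | t \<in> D i \<and> s i t = p. sgn (normal_vec (s i) t \<bullet> \<nu>)) = 1"
    using rep unfolding represents_boundary_def by blast
  obtain B where B: "B > 0" "R \<subseteq> cball x0 B"
    using bounded_subset_ballD [OF compact_imp_bounded [OF R], of x0] ball_subset_cball by blast
  define cone where "cone = {x0 + \<rho> *\<^sub>R (p - x0) | \<rho> p. \<rho> \<in> {0..1} \<and> p \<in> E \<inter> cball x0 B}"
  define F1 where "F1 i = cone_map x0 (s i) ` ({0..1} \<times> frontier (D i))" for i
  define F2 where "F2 i = cone_map x0 (s i) `
      {y \<in> {0..1} \<times> D i. scaling_jacobian x0 (s i) (fst y) (snd y) = 0}" for i
  \<comment> \<open>Excluding \<open>x0\<close> makes the ray nondegenerate; the cone keeps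
    exceptional boundary points off the ray beyond \<open>x\<close>; the frontier ensures that
    \<open>l = 1\<close> is no crossing; \<open>F1\<close> forces parameters into the interior of
    their domains, and \<open>F2\<close> forces nonzero Jacobians.\<close>
  define N where "N = {x0} \<union> cone \<union> frontier R \<union> (\<Union>i\<in>{1..m}. F1 i \<union> F2 i)"
  have closedR: "closed R" using R by (rule compact_imp_closed)
  have "negligible N"
    unfolding N_def
  proof (intro negligible_Un negligible_sing)
    show "negligible cone"
      unfolding cone_def by (rule negligible_cone_hausdorff_null [OF _ _ E]) auto
    have "negligible (\<Union>i\<in>{1..m}. s i ` D i)"
      using negligible_patch [OF compD frD V] by (intro negligible_Union) auto
    then show "negligible (frontier R)" by (simp only: cover)
    have "negligible (F1 i)" "negligible (F2 i)" if "i \<in> {1..m}" for i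
      using negligible_cone_frontier [OF compD frD V] negligible_cone_critical [OF compD frD V] that
      by (auto simp: F1_def F2_def)
    then show "negligible (\<Union>i\<in>{1..m}. F1 i \<union> F2 i)"
      by (intro negligible_Union) auto
  qed
  moreover
  have main: "(\<forall>i\<in>{1..m}. finite {y \<in> cone_dom x0 (D i) (s i). cone_map x0 (s i) y = x}) \<and>
    (\<Sum>i=1..m. \<Sum>y | y \<in> cone_dom x0 (D i) (s i) \<and> cone_map x0 (s i) y = x.
        sgn (scaling_jacobian x0 (s i) (fst y) (snd y))) = indicator R x" if x: "x \<notin> N" for x
  proof -
    define v where "v = x - x0"
    have v0: "v \<noteq> 0" using x by (auto simp: v_def N_def)
    define P where "P = {l. l > 1 \<and> x0 + l *\<^sub>R v \<in> frontier R}"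
    define A where "A = {l. x0 + l *\<^sub>R v \<in> R}"
    define \<tau> where "\<tau> l = (\<Sum>i=1..m. \<Sum>t | t \<in> D i \<and> s i t = x0 + l *\<^sub>R v.
        sgn (tangent_det (s i) t (s i t - x0)))" for l
    have ray: "x = cone_map x0 (s i) (1 / l, t)" if "l > 1" "s i t = x0 + l *\<^sub>R v" for i l t
      using that by (simp add: cone_map_def scaling_map_def v_def)
    have inD: "t \<in> interior (D i) \<and> scaling_jacobian x0 (s i) (1 / l) t \<noteq> 0"
      if i: "i \<in> {1..m}" and l: "l > 1" and t: "t \<in> D i" "s i t = x0 + l *\<^sub>R v" for i l t
    proof
      have mem: "1 / l \<in> {0..1}" using l by simp
      have "x \<notin> F1 i" "x \<notin> F2 i" using x i by (auto simp: N_def)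
      then have "(1 / l, t) \<notin> {0..1} \<times> frontier (D i)"
        "(1 / l, t) \<notin> {y \<in> {0..1} \<times> D i. scaling_jacobian x0 (s i) (fst y) (snd y) = 0}"
        using ray [OF l t(2)] unfolding F1_def F2_def by blast+
      then have "t \<notin> frontier (D i)" and J: "scaling_jacobian x0 (s i) (1 / l) t \<noteq> 0"
        using mem t(1) by auto
      then show "t \<in> interior (D i)" using t(1) closure_subset by (auto simp: frontier_def)
      show "scaling_jacobian x0 (s i) (1 / l) t \<noteq> 0" by (rule J)
    qed
    have crossing: "(\<forall>i\<in>{1..m}. finite {t \<in> D i. s i t = x0 + l *\<^sub>R v}) \<and>
        (\<exists>e>0. ((\<tau> l = 1 \<and> {l-e<..<l} \<subseteq> A \<and> {l<..<l+e} \<inter> A = {}) \<or>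
          (\<tau> l = -1 \<and> {l-e<..<l} \<inter> A = {} \<and> {l<..<l+e} \<subseteq> A)) \<and>
          (\<forall>k. k \<noteq> l \<longrightarrow> \<bar>k - l\<bar> < e \<longrightarrow> x0 + k *\<^sub>R v \<notin> frontier R))" if l: "l \<in> P" for l
    proof -
      define p where "p = x0 + l *\<^sub>R v"
      have l1: "l > 1" and pR: "p \<in> frontier R" using l by (auto simp: P_def p_def)
      have "p \<in> cball x0 B" using pR B(2) closedR by (auto simp: frontier_def)
      \<comment> \<open>\<open>x\<close> lies on the segment from \<open>x0\<close> to
        \<open>p\<close>, so an exceptional \<open>p\<close> would put \<open>x\<close> into the
        cone.\<close>
      have "p \<notin> E"
      proof
        assume "p \<in> E"
        have "x = x0 + (1 / l) *\<^sub>R (p - x0)" using l1 by (simp add: p_def v_def)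
        moreover have "1 / l \<in> {0..1}" using l1 by simp
        ultimately have "x \<in> cone" unfolding cone_def using \<open>p \<in> E\<close> \<open>p \<in> cball x0 B\<close> by blast
        then show False using x by (simp add: N_def)
      qed
      then obtain \<nu> where \<nu>: "outward_unit_normal R p \<nu>"
        and fin: "\<And>i. i \<in> {1..m} \<Longrightarrow> finite {t \<in> D i. s i t = p}"
        and one: "(\<Sum>i=1..m. \<Sum>t | t \<in> D i \<and> s i t = p. sgn (normal_vec (s i) t \<bullet> \<nu>)) = 1"
        using good [of p] pR by blast
      obtain U g c where n1: "norm \<nu> = 1" and U: "open U" "p \<in> U" and "Ck_on 1 g U"
        and RU: "R \<inter> U = {x \<in> U. g x \<le> 0}" and gp: "g p = 0" and c: "c > 0"
        and grad: "(g has_derivative (\<lambda>v. c * (\<nu> \<bullet> v))) (at p)"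
        using \<nu> unfolding outward_unit_normal_def by blast
      then have contg: "continuous_on U g" by (auto intro: differentiable_imp_continuous_on)
      \<comment> \<open>On the ray \<open>s i t - x0\<close> equals \<open>l *\<^sub>R v\<close>, so
        the determinant splits into patch orientation and crossing direction.\<close>
      have td: "tangent_det (s i) t (s i t - x0) = (normal_vec (s i) t \<bullet> \<nu>) * (l * (\<nu> \<bullet> v))"
        if i: "i \<in> {1..m}" and t: "t \<in> D i" "s i t = p" for i t
      proof -
        have tI: "t \<in> interior (D i)" using inD [OF i l1 t(1)] t(2) by (simp add: p_def)
        have sub: "s i ` D i \<subseteq> frontier R" using cover i by blast
        have tV: "t \<in> V i" using V(2) [OF i] t(1) by blast
        have "tangent_det (s i) t (s i t - x0) = (normal_vec (s i) t \<bullet> \<nu>) * (\<nu> \<bullet> (s i t - x0))"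
          by (rule tangent_det_normal [OF n1])
            (rule tangent_orthogonal_gradient [OF closedR U contg gp RU c grad tI sub t(2)
              patch_has_derivative [OF compD [OF i] frD [OF i] V(1,2,3) [OF i] tV]])
        then show ?thesis by (simp add: t(2) p_def)
      qed
      obtain i t where it: "i \<in> {1..m}" "t \<in> D i" "s i t = p"
        using pR unfolding cover [symmetric] by blast
      \<comment> \<open>The patches cover the frontier, so \<open>p\<close> has at least one
        parameter; its nonzero determinant shows through the factorization that the ray is
        transversal.\<close>
      have "tangent_det (s i) t (s i t - x0) \<noteq> 0"
        using inD [OF it(1) l1 it(2)] it(3) by (auto simp: scaling_jacobian_def p_def)
      then have nz: "\<nu> \<bullet> v \<noteq> 0" using td [OF it] by auto
      have "\<tau> l = (\<Sum>i=1..m. \<Sum>t | t \<in> D i \<and> s i t = p. sgn (normal_vec (s i) t \<bullet> \<nu>) * sgn (\<nu> \<bullet> v))"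
        unfolding \<tau>_def p_def [symmetric]
      proof (intro sum.cong refl)
        fix i t assume "i \<in> {1..m}" "t \<in> {t. t \<in> D i \<and> s i t = p}"
        then show "sgn (tangent_det (s i) t (s i t - x0)) = sgn (normal_vec (s i) t \<bullet> \<nu>) * sgn (\<nu> \<bullet> v)"
          using td [of i t] l1 by (simp add: sgn_mult)
      qed
      \<comment> \<open>The crossing direction is common to all parameters of \<open>p\<close>, and
        the orientations left over add up to 1.\<close>
      also have "\<dots> = sgn (\<nu> \<bullet> v)"
        unfolding sum_distrib_right [symmetric] one by simp
      finally have \<tau>: "\<tau> l = sgn (\<nu> \<bullet> v)" .
      show ?thesis
        using fin ray_crossing [OF closedR U contg gp RU c grad p_def nz]
        unfolding \<tau> A_def p_def by blast
    qed
    have "bounded A"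
    proof (rule boundedI)
      fix l assume "l \<in> A"
      then have "x0 + l *\<^sub>R v \<in> cball x0 B" using B(2) by (auto simp: A_def)
      then have "\<bar>l\<bar> * norm v \<le> B" by (simp add: dist_norm)
      then show "norm l \<le> B / norm v" using v0 by (simp add: field_simps)
    qed
    then obtain M where M: "A \<subseteq> {..M}"
      by (metis atMost_iff bounded_has_Sup(1) empty_subsetI subsetI)
    \<comment> \<open>As \<open>x\<close> is not on the frontier, the strict bound
      \<open>l > 1\<close> may be relaxed to \<open>l \<ge> 1\<close>, which makes \<open>P\<close>
      closed.\<close>
    have P': "P = {1..} \<inter> (\<lambda>l. x0 + l *\<^sub>R v) -` frontier R"
    proof -
      have "x0 + 1 *\<^sub>R v \<notin> frontier R" using x by (simp add: v_def N_def)
      then show ?thesis by (auto simp: P_def less_le)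
    qed
    have "finite P"
    proof (rule finite_if_isolated)
      have "P \<subseteq> A" using frontier_subset_closed [OF closedR] by (auto simp: P_def A_def)
      then have "bounded P" using \<open>bounded A\<close> bounded_subset by blast
      moreover have "closed P"
        unfolding P' by (intro closed_Int closed_vimage continuous_intros) auto
      ultimately show "compact P" by (simp add: compact_eq_bounded_closed)
      show "\<exists>e>0. \<forall>k. k \<noteq> l \<longrightarrow> \<bar>k - l\<bar> < e \<longrightarrow> k \<notin> P" if "l \<in> P" for l
        using crossing [OF that] unfolding P_def by blast
    qed
    have sumP: "(\<Sum>l\<in>P. \<tau> l) = indicator A 1"
    proof (rule crossing_sum [OF \<open>finite P\<close> _ _ M])
      \<comment> \<open>Off the frontier of \<open>R\<close> the point lies in the open interior or
        the open complement, and the continuous ray pulls both back to open sets.\<close>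
      show "l \<notin> frontier A" if "l \<ge> 1" "l \<notin> P" for l
      proof
        assume "l \<in> frontier A"
        have nf: "x0 + l *\<^sub>R v \<notin> frontier R" using that unfolding P' by simp
        have cont: "open ((\<lambda>l. x0 + l *\<^sub>R v) -` W)" if "open W" for W
          by (rule open_vimage [OF that]) (intro continuous_intros)
        have "l \<in> interior A \<or> l \<in> interior (- A)"
        proof (cases "x0 + l *\<^sub>R v \<in> interior R")
          case True
          have "(\<lambda>l. x0 + l *\<^sub>R v) -` interior R \<subseteq> A" using interior_subset by (auto simp: A_def)
          then show ?thesis using True cont [of "interior R"] by (blast intro: interiorI)
        next
          case False
          then have "x0 + l *\<^sub>R v \<in> - R"
            using nf closure_subset by (auto simp: frontier_def)
          moreover have "(\<lambda>l. x0 + l *\<^sub>R v) -` (- R) \<subseteq> - A" by (auto simp: A_def)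
          moreover have "open (- R)" using closedR by (simp add: open_Compl)
          ultimately show ?thesis using cont [of "- R"] by (blast intro: interiorI)
        qed
        then show False using \<open>l \<in> frontier A\<close> by (auto simp: frontier_def interior_complement)
      qed
      show "P \<subseteq> {1<..}" by (auto simp: P_def)
      show "\<exists>e>0. (\<tau> l = 1 \<and> {l-e<..<l} \<subseteq> A \<and> {l<..<l+e} \<inter> A = {}) \<or>
          (\<tau> l = -1 \<and> {l-e<..<l} \<inter> A = {} \<and> {l<..<l+e} \<subseteq> A)" if "l \<in> P" for l
        using crossing [OF that] by blast
    qed
    have finT: "finite {t \<in> D i. s i t = x0 + l *\<^sub>R (x - x0)}" if "i \<in> {1..m}" "l \<in> P" for i l
      using crossing [OF that(2)] that(1) unfolding v_def by blast
    have P1: "P \<subseteq> {1<..}" by (auto simp: P_def)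
    have goodP: "t \<in> interior (D i) \<and> scaling_jacobian x0 (s i) (1 / l) t \<noteq> 0"
      if "i \<in> {1..m}" "l \<in> P" "t \<in> D i" "s i t = x0 + l *\<^sub>R (x - x0)" for i l t
      using inD [of i l t] that by (simp add: P_def v_def)
    have allP: "l \<in> P" if "i \<in> {1..m}" "l > 1" "t \<in> D i" "s i t = x0 + l *\<^sub>R (x - x0)" for i l t
    proof -
      have "s i t \<in> frontier R" using cover that by blast
      then show ?thesis using that by (simp add: P_def v_def)
    qed
    have fibre: "finite {y \<in> cone_dom x0 (D i) (s i). cone_map x0 (s i) y = x}"
      "(\<Sum>y | y \<in> cone_dom x0 (D i) (s i) \<and> cone_map x0 (s i) y = x.
          sgn (scaling_jacobian x0 (s i) (fst y) (snd y))) =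
        (\<Sum>l\<in>P. \<Sum>t | t \<in> D i \<and> s i t = x0 + l *\<^sub>R (x - x0). sgn (tangent_det (s i) t (s i t - x0)))"
      if "i \<in> {1..m}" for i
      using sum_cone_fibre [OF \<open>finite P\<close> P1, of "D i" "s i" x0 x] finT goodP allP that by blast+
    have "(\<Sum>i=1..m. \<Sum>y | y \<in> cone_dom x0 (D i) (s i) \<and> cone_map x0 (s i) y = x.
        sgn (scaling_jacobian x0 (s i) (fst y) (snd y))) =
      (\<Sum>i=1..m. \<Sum>l\<in>P. \<Sum>t | t \<in> D i \<and> s i t = x0 + l *\<^sub>R (x - x0). sgn (tangent_det (s i) t (s i t - x0)))"
      by (intro sum.cong refl fibre(2))
    also have "\<dots> = (\<Sum>l\<in>P. \<tau> l)" unfolding \<tau>_def v_def by (rule sum.swap)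
    also have "\<dots> = indicator R x" unfolding sumP by (simp add: A_def v_def indicator_def)
    finally show ?thesis using fibre(1) by blast
  qed
  ultimately show ?thesis using that [of N] by blast
qed

theorem mainTheorem1:
  fixes R :: "(real^('k::finite) option) set"
    and m :: nat
    and D :: "nat \<Rightarrow> (real^'k) set"
    and s :: "nat \<Rightarrow> real^'k \<Rightarrow> real^'k option"
    and x0 :: "real^'k option"
    and f :: "real^'k option \<Rightarrow> real"
    and U :: "(real^'k option) set"
  assumes "compact R"
    and "represents_boundary m D s R"
    and "open U" and "scaled_region m D s x0 \<subseteq> U" and "smooth_on f U"
  shows "integral R f =
    (\<Sum>i=1..m. integral {0..1} (\<lambda>\<rho>. integral (D i)
       (\<lambda>t. f (scaling_map x0 (s i) \<rho> t) * scaling_jacobian x0 (s i) \<rho> t)))"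
proof -
  obtain N where N: "negligible N"
    "\<And>i x. i \<in> {1..m} \<Longrightarrow> x \<notin> N \<Longrightarrow> finite {y \<in> cone_dom x0 (D i) (s i). cone_map x0 (s i) y = x}"
    "\<And>x. x \<notin> N \<Longrightarrow> (\<Sum>i=1..m. \<Sum>y | y \<in> cone_dom x0 (D i) (s i) \<and> cone_map x0 (s i) y = x.
        sgn (scaling_jacobian x0 (s i) (fst y) (snd y))) = indicator R x"
    by (rule oriented_multiplicity [OF assms(1,2), of x0]) blast
  define k where "k i x = f x * (\<Sum>y | y \<in> cone_dom x0 (D i) (s i) \<and> cone_map x0 (s i) y = x.
      sgn (scaling_jacobian x0 (s i) (fst y) (snd y)))" for i x
  have "Ck_on 0 f U" using assms(5) unfolding smooth_on_def by blast
  then have contf: "continuous_on U f" by simp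
  have k: "k i absolutely_integrable_on UNIV"
    "integral UNIV (k i) = integral {0..1} (\<lambda>\<rho>. integral (D i)
       (\<lambda>t. f (scaling_map x0 (s i) \<rho> t) * scaling_jacobian x0 (s i) \<rho> t))"
    if i: "i \<in> {1..m}" for i
  proof -
    have "patch (D i) (s i)" using assms(2) i by (auto simp: represents_boundary_def)
    then obtain V where V: "compact (D i)" "negligible (frontier (D i))" "open V" "D i \<subseteq> V"
      "Ck_on 1 (s i) V" by (auto simp: patch_def)
    have "cone_map x0 (s i) ` ({0..1} \<times> D i) \<subseteq> U"
      using assms(4) i by (fastforce simp: scaled_region_def cone_map_def)
    then have "continuous_on (cone_map x0 (s i) ` ({0..1} \<times> D i)) f"
      using contf continuous_on_subset by blast
    note ci = cone_integral [OF V this N(1)]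
    show "k i absolutely_integrable_on UNIV"
      unfolding k_def [abs_def] by (rule ci(1)) (erule N(2) [OF i])
    show "integral UNIV (k i) = integral {0..1} (\<lambda>\<rho>. integral (D i)
       (\<lambda>t. f (scaling_map x0 (s i) \<rho> t) * scaling_jacobian x0 (s i) \<rho> t))"
      unfolding k_def [abs_def] by (rule ci(2)) (erule N(2) [OF i])
  qed
  have "integral R f = integral UNIV (\<lambda>x. if x \<in> R then f x else 0)"
    by (rule integral_restrict_UNIV [symmetric])
  \<comment> \<open>Off \<open>N\<close> the signed counts add up to the indicator of
    \<open>R\<close>. In particular almost every point of \<open>R\<close> has a nonempty fibre and
    so lies in \<open>scaled_region m D s x0\<close>, where \<open>f\<close> is controlled.\<close>
  also have "\<dots> = integral UNIV (\<lambda>x. \<Sum>i=1..m. k i x)"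
  proof (rule integral_spike [OF N(1)])
    fix x assume "x \<in> UNIV - N"
    then have "(\<Sum>i=1..m. k i x) = f x * indicator R x"
      unfolding k_def sum_distrib_left [symmetric] using N(3) by simp
    then show "(\<Sum>i=1..m. k i x) = (if x \<in> R then f x else 0)" by (simp add: indicator_def)
  qed
  also have "\<dots> = (\<Sum>i=1..m. integral UNIV (k i))"
    by (rule integral_sum) (use k(1) in \<open>auto simp: absolutely_integrable_on_def\<close>)
  also have "\<dots> = (\<Sum>i=1..m. integral {0..1} (\<lambda>\<rho>. integral (D i)
       (\<lambda>t. f (scaling_map x0 (s i) \<rho> t) * scaling_jacobian x0 (s i) \<rho> t)))"
    by (intro sum.cong refl k(2))
  finally show ?thesis .
qed

end
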